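(* Let $\Theta\in\mathbf S(\mathfrak M,\mathfrak N)$ and let $\{\Gamma_k\}_{k\ge0}$ be its Schur parameters. Suppose that $\mathfrak D_{\Gamma_{2n+1}}\ne\{0\}$ and $\mathfrak D_{\Gamma_{2n+1}^*}\ne\{0\}$ for some $n\ge0$. Then $\Theta$ and the $(2n+2)$-th associated function $\Theta_{2n+2}$ are connected, for all $z\in\mathbb D$, by the relations $$\begin{aligned}\Theta(z)&=\Theta_n^{(0)}(z)+C_n(z)\left(I_{\mathfrak D_{\Gamma^*_{2n+1}}}-\Theta_{2n+2}(z)A_n(z)\right)^{-1}\Theta_{2n+2}(z)B_n(z)\\ &=\Theta_n^{(0)}(z)+C_n(z)\Theta_{2n+2}(z)\left(I_{\mathfrak D_{\Gamma_{2n+1}}}-A_n(z)\Theta_{2n+2}(z)\right)^{-1}B_n(z),\end{aligned}$$ where $\Theta_n^{(0)},C_n,B_n,A_n$ are the entries of the Schur class function $\mathcal Q_n(z)=\begin{bmatrix}\Theta^{(0)}_n(z)&C_n(z)\\ B_n(z)&A_n(z)\end{bmatrix}\in\mathbf S(\mathfrak M\oplus\mathfrak D_{\Gamma^*_{2n+1}},\mathfrak N\oplus\mathfrak D_{\Gamma_{2n+1}})$ defined, with $R(z)=(I_{\mathcal K_n}-z\mathcal S_{n,0})^{-1}$, by $$\begin{aligned}\Theta^{(0)}_n(z)&=\Gamma_0+zD_{\Gamma_0^*}\begin{bmatrix}\Gamma_1&D_{\Gamma_1^*}\end{bmatrix}\left(P_{\mathcal H_1}R(z)\upharpoonright\mathfrak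 D_{\Gamma_0}\right)D_{\Gamma_0},\\ A_n(z)&=z\begin{bmatrix}D_{\Gamma_{2n+1}}&-\Gamma^*_{2n+1}\end{bmatrix}\left(P_{\mathcal H_{n+1}}R(z)\upharpoonright\mathfrak D_{\Gamma^*_{2n+1}}\right),\\ B_n(z)&=z\begin{bmatrix}D_{\Gamma_{2n+1}}&-\Gamma^*_{2n+1}\end{bmatrix}\left(P_{\mathcal H_{n+1}}R(z)\upharpoonright\mathfrak D_{\Gamma_0}\right)D_{\Gamma_0},\\ C_n(z)&=zD_{\Gamma_0^*}\begin{bmatrix}\Gamma_1&D_{\Gamma_1^*}\end{bmatrix}\left(P_{\mathcal H_1}R(z)\upharpoonright\mathfrak D_{\Gamma^*_{2n+1}}\right).\end{aligned}$$
   Context: All Hilbert spaces are complex (infinite-dimensional ones are separable). $\mathbf L(H_1,H_2)$ denotes the bounded operators; $P_L$ is the orthogonal projection onto a subspace $L$ (regarded as a map into $L$), $X\upharpoonright L$ is restriction. For a contraction $T$: $D_T=(I-T^*T)^{1/2}$, $\mathfrak D_T=\overline{\operatorname{ran}}\,D_T$. $\mathbf S(\mathfrak M,\mathfrak N)$ is the Schur class: holomorphic $\Theta:\mathbb D\to\mathbf L(\mathfrak M,\mathfrak N)$ with $\|\Theta(z)\|\le1$. Schur algorithm: $\Theta_0=\Theta$, $\Gamma_k=\Theta_k(0)$, and $\Theta_{k+1}\in\mathbf S(\mathfrak D_{\Gamma_k},\mathfrak D_{\Gamma_k^*})$ is the unique function with $\Theta_k(z)=\Gamma_k+zD_{\Gamma_k^*}\Theta_{k+1}(z)(I+z\Gamma_k^*\Theta_{k+1}(z))^{-1}D_{\Gamma_k}$,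 $z\in\mathbb D$. The $\Gamma_k$ are the Schur parameters of $\Theta$ and $\Theta_k$ is the $k$-th associated function; $\Gamma_0\in\mathbf L(\mathfrak M,\mathfrak N)$, $\Gamma_k\in\mathbf L(\mathfrak D_{\Gamma_{k-1}},\mathfrak D_{\Gamma_{k-1}^*})$, $k\ge1$. Elementary rotations, for $k\ge1$, are the unitary operators $$\mathbf J_{\Gamma_k}=\begin{bmatrix}\Gamma_k&D_{\Gamma_k^*}\\ D_{\Gamma_k}&-\Gamma_k^*\end{bmatrix}:\mathfrak D_{\Gamma_{k-1}}\oplus\mathfrak D_{\Gamma_k^*}\to\mathfrak D_{\Gamma_{k-1}^*}\oplus\mathfrak D_{\Gamma_k}.$$ Put $\mathcal H_k=\mathfrak D_{\Gamma_{2k-2}}\oplus\mathfrak D_{\Gamma^*_{2k-1}}$, $\widetilde{\mathcal H}_k=\mathfrak D_{\Gamma^*_{2k-2}}\oplus\mathfrak D_{\Gamma_{2k-1}}$ ($1\le k\le n+1$), $\mathcal K_n=\bigoplus_{k=1}^{n+1}\mathcal H_k$, $\widetilde{\mathcal K}_n=\bigoplus_{k=1}^{n+1}\widetilde{\mathcal H}_k$. The operator $\mathcal S_{n,0}$ on $\mathcal K_n$ is $\mathcal S_{n,0}=\mathcal W_{n,0}\mathcal V_n$, where $\mathcal V_n=\bigoplus_{k=1}^{n+1}\mathbf J_{\Gamma_{2k-1}}:\mathcal K_n\to\widetilde{\mathcal K}_n$ and $\mathcal W_{n,0}=-\Gamma_0^*\oplus\bigoplus_{k=1}^n\mathbf J_{\Gamma_{2k}}\oplus0$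 maps $\widetilde{\mathcal K}_n=\mathfrak D_{\Gamma_0^*}\oplus\bigoplus_{k=1}^n(\mathfrak D_{\Gamma_{2k-1}}\oplus\mathfrak D_{\Gamma_{2k}^*})\oplus\mathfrak D_{\Gamma_{2n+1}}$ to $\mathcal K_n=\mathfrak D_{\Gamma_0}\oplus\bigoplus_{k=1}^n(\mathfrak D_{\Gamma_{2k-1}^*}\oplus\mathfrak D_{\Gamma_{2k}})\oplus\mathfrak D_{\Gamma_{2n+1}^*}$. The rows $\begin{bmatrix}\Gamma_1&D_{\Gamma_1^*}\end{bmatrix}$ and $\begin{bmatrix}D_{\Gamma_{2n+1}}&-\Gamma^*_{2n+1}\end{bmatrix}$ act from $\mathcal H_1=\mathfrak D_{\Gamma_0}\oplus\mathfrak D_{\Gamma_1^*}$ to $\mathfrak D_{\Gamma_0^*}$ and from $\mathcal H_{n+1}=\mathfrak D_{\Gamma_{2n}}\oplus\mathfrak D_{\Gamma_{2n+1}^*}$ to $\mathfrak D_{\Gamma_{2n+1}}$, respectively. *)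

theory Defs
  imports "HOL-Analysis.Analysis"
begin

section \<open>Complex Hilbert spaces\<close>

class complex_vector = real_vector +
  fixes scaleC :: "complex \<Rightarrow> 'a \<Rightarrow> 'a" (infixr \<open>*C\<close> 75)
  assumes scaleC_add_right: "a *C (x + y) = a *C x + a *C y"
    and scaleC_add_left: "(a + b) *C x = a *C x + b *C x"
    and scaleC_scaleC: "a *C (b *C x) = (a * b) *C x"
    and scaleR_scaleC: "r *\<^sub>R x = complex_of_real r *C x"

text \<open>The inner product is linear in the first argument. Positive definiteness is contained in
  \<open>cinner_self\<close>, since the norm of a normed space is nonnegative and definite.\<close>

class complex_inner = complex_vector + real_normed_vector +
  fixes cinner :: "'a \<Rightarrow> 'a \<Rightarrow> complex"
  assumes cinner_commute: "cinner x y = cnj (cinner y x)"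
    and cinner_add_left: "cinner (x + y) w = cinner x w + cinner y w"
    and cinner_scaleC_left: "cinner (a *C x) y = a * cinner x y"
    and cinner_self: "cinner x x = complex_of_real ((norm x)\<^sup>2)"

class complex_hilbert = complex_inner + banach

text \<open>The type product is the orthogonal direct sum.\<close>

instantiation prod :: (complex_vector, complex_vector) complex_vector
begin
definition scaleC_prod_def: "a *C p = (a *C fst p, a *C snd p)"
instance
  by standard
    (simp_all add: scaleC_prod_def scaleC_add_right scaleC_add_left scaleC_scaleC
      scaleR_prod_def scaleR_scaleC)
end

instantiation prod :: (complex_inner, complex_inner) complex_inner
begin
definition cinner_prod_def: "cinner p q = cinner (fst p) (fst q) + cinner (snd p) (snd q)"
instance
proof
  fix x y w :: "'a \<times> 'b" and a :: complex
  show "cinner x y = cnj (cinner y x)"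
    unfolding cinner_prod_def
    using cinner_commute[of "fst x" "fst y"] cinner_commute[of "snd x" "snd y"] by simp
  show "cinner (x + y) w = cinner x w + cinner y w"
    by (simp add: cinner_prod_def cinner_add_left)
  show "cinner (a *C x) y = a * cinner x y"
    by (simp add: cinner_prod_def scaleC_prod_def cinner_scaleC_left distrib_left)
  show "cinner x x = complex_of_real ((norm x)\<^sup>2)"
    by (simp add: cinner_prod_def cinner_self norm_prod_def)
qed
end

instance prod :: (complex_hilbert, complex_hilbert) complex_hilbert ..

section \<open>Operators between closed subspaces\<close>

text \<open>Since the defect spaces depend on operators, operators between Hilbert spaces are
  represented by functions between the ambient types together with the closed subspaces
  \<open>L\<close> (domain) and \<open>K\<close> (codomain). Only the values on \<open>L\<close> are meaningful; everything below
  is stated on \<open>L\<close> only.\<close>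

definition bounded_op :: "'a::complex_inner set \<Rightarrow> 'b::complex_inner set \<Rightarrow> ('a \<Rightarrow> 'b) \<Rightarrow> bool" where
  "bounded_op L K T \<longleftrightarrow>
     (\<forall>x\<in>L. T x \<in> K) \<and>
     (\<forall>x\<in>L. \<forall>y\<in>L. T (x + y) = T x + T y) \<and>
     (\<forall>a. \<forall>x\<in>L. T (a *C x) = a *C T x) \<and>
     (\<exists>B. \<forall>x\<in>L. norm (T x) \<le> B * norm x)"

definition adjoint_on :: "'a::complex_inner set \<Rightarrow> ('a \<Rightarrow> 'b::complex_inner) \<Rightarrow> 'b \<Rightarrow> 'a" where
  "adjoint_on L T y = (THE x. x \<in> L \<and> (\<forall>v\<in>L. cinner (T v) y = cinner v x))"

definition positive_op :: "'a::complex_inner set \<Rightarrow> ('a \<Rightarrow> 'a) \<Rightarrow> bool" where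
  "positive_op L R \<longleftrightarrow> bounded_op L L R \<and> (\<forall>x\<in>L. cinner (R x) x \<in> \<real>\<^sub>\<ge>\<^sub>0)"

text \<open>The positive square root of a positive operator is unique on \<open>L\<close>; the choice only affects
  the irrelevant values outside \<open>L\<close>.\<close>

definition sqrt_op :: "'a::complex_inner set \<Rightarrow> ('a \<Rightarrow> 'a) \<Rightarrow> 'a \<Rightarrow> 'a" where
  "sqrt_op L A = (SOME R. positive_op L R \<and> (\<forall>x\<in>L. R (R x) = A x))"

definition defect_op :: "'a::complex_inner set \<Rightarrow> ('a \<Rightarrow> 'b::complex_inner) \<Rightarrow> 'a \<Rightarrow> 'a" where
  "defect_op L T = sqrt_op L (\<lambda>x. x - adjoint_on L T (T x))"

definition defect_space :: "'a::complex_inner set \<Rightarrow> ('a \<Rightarrow> 'b::complex_inner) \<Rightarrow> 'a set" where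
  "defect_space L T = closure (defect_op L T ` L)"

section \<open>The Schur class and the Schur algorithm\<close>

text \<open>Holomorphy on the unit disk is complex differentiability in the operator norm.\<close>

definition op_holomorphic ::
  "'a::complex_inner set \<Rightarrow> 'b::complex_inner set \<Rightarrow> (complex \<Rightarrow> 'a \<Rightarrow> 'b) \<Rightarrow> bool" where
  "op_holomorphic L K F \<longleftrightarrow>
     (\<forall>z\<in>ball 0 1. \<exists>F'. bounded_op L K F' \<and>
        (\<forall>e>0. \<forall>\<^sub>F w in at z. \<forall>x\<in>L.
           norm (inverse (w - z) *C (F w x - F z x) - F' x) \<le> e * norm x))"

definition schur_class ::
  "'a::complex_inner set \<Rightarrow> 'b::complex_inner set \<Rightarrow> (complex \<Rightarrow> 'a \<Rightarrow> 'b) set" where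
  "schur_class L K =
     {F. (\<forall>z\<in>ball 0 1. bounded_op L K (F z) \<and> (\<forall>x\<in>L. norm (F z x) \<le> norm x)) \<and>
         op_holomorphic L K F}"

text \<open>A sequence of parameters \<open>G k\<close> acts from \<open>par_dom G k\<close> to \<open>par_cod G k\<close>: from the whole
  space to the whole space for \<open>k = 0\<close>, and from \<open>dsp G (k - 1)\<close> to \<open>dsp_star G (k - 1)\<close>
  (defined below) for \<open>k \<ge> 1\<close>.\<close>

primrec par_dom :: "(nat \<Rightarrow> 'm::complex_inner \<Rightarrow> 'n::complex_inner) \<Rightarrow> nat \<Rightarrow> 'm set" where
  "par_dom G 0 = UNIV"
| "par_dom G (Suc k) = defect_space (par_dom G k) (G k)"

definition par_adj :: "(nat \<Rightarrow> 'm::complex_inner \<Rightarrow> 'n::complex_inner) \<Rightarrow> nat \<Rightarrow> 'n \<Rightarrow> 'm" where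
  "par_adj G k = adjoint_on (par_dom G k) (G k)"

primrec par_cod :: "(nat \<Rightarrow> 'm::complex_inner \<Rightarrow> 'n::complex_inner) \<Rightarrow> nat \<Rightarrow> 'n set" where
  "par_cod G 0 = UNIV"
| "par_cod G (Suc k) = defect_space (par_cod G k) (par_adj G k)"

text \<open>For \<open>\<Gamma> = G k\<close>: the operators \<open>D\<^sub>\<Gamma>\<close>, \<open>D\<^sub>\<Gamma>\<^sub>*\<close> and the defect spaces of \<open>\<Gamma>\<close> and \<open>\<Gamma>*\<close>.\<close>

definition dop :: "(nat \<Rightarrow> 'm::complex_inner \<Rightarrow> 'n::complex_inner) \<Rightarrow> nat \<Rightarrow> 'm \<Rightarrow> 'm" where
  "dop G k = defect_op (par_dom G k) (G k)"

definition dop_star :: "(nat \<Rightarrow> 'm::complex_inner \<Rightarrow> 'n::complex_inner) \<Rightarrow> nat \<Rightarrow> 'n \<Rightarrow> 'n" where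
  "dop_star G k = defect_op (par_cod G k) (par_adj G k)"

definition dsp :: "(nat \<Rightarrow> 'm::complex_inner \<Rightarrow> 'n::complex_inner) \<Rightarrow> nat \<Rightarrow> 'm set" where
  "dsp G k = defect_space (par_dom G k) (G k)"

definition dsp_star :: "(nat \<Rightarrow> 'm::complex_inner \<Rightarrow> 'n::complex_inner) \<Rightarrow> nat \<Rightarrow> 'n set" where
  "dsp_star G k = defect_space (par_cod G k) (par_adj G k)"

text \<open>\<open>T k\<close> is the \<open>k\<close>-th associated function of \<open>F\<close> and \<open>G k\<close> its \<open>k\<close>-th Schur parameter.
  The relation determines \<open>T k\<close> on the disk and \<open>G k\<close>, as operators on \<open>par_dom G k\<close>, uniquely.\<close>

definition schur_algorithm ::
  "(complex \<Rightarrow> 'm::complex_inner \<Rightarrow> 'n::complex_inner) \<Rightarrow> (nat \<Rightarrow> complex \<Rightarrow> 'm \<Rightarrow> 'n) \<Rightarrow>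
   (nat \<Rightarrow> 'm \<Rightarrow> 'n) \<Rightarrow> bool" where
  "schur_algorithm F T G \<longleftrightarrow>
     T 0 = F \<and>
     (\<forall>k. G k = T k 0) \<and>
     (\<forall>k. T (Suc k) \<in> schur_class (dsp G k) (dsp_star G k)) \<and>
     (\<forall>k. \<forall>z\<in>ball 0 1. \<forall>x\<in>par_dom G k.
        T k z x = G k x +
          z *C dop_star G k (T (Suc k) z
            (the_inv_into (dsp G k) (\<lambda>v. v + z *C par_adj G k (T (Suc k) z v)) (dop G k x))))"

section \<open>The operator S and the function Q\<close>

definition rotation ::
  "(nat \<Rightarrow> 'm::complex_inner \<Rightarrow> 'n::complex_inner) \<Rightarrow> nat \<Rightarrow> 'm \<times> 'n \<Rightarrow> 'n \<times> 'm" where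
  "rotation G k = (\<lambda>(x, y). (G k x + dop_star G k y, dop G k x - par_adj G k y))"

text \<open>An element of the direct sum of \<open>n + 1\<close> summands is a sequence, with the \<open>k\<close>-th component
  at index \<open>k \<in> {1..n + 1}\<close> and \<open>0\<close> elsewhere.\<close>

definition H_sp :: "(nat \<Rightarrow> 'm::complex_inner \<Rightarrow> 'n::complex_inner) \<Rightarrow> nat \<Rightarrow> ('m \<times> 'n) set" where
  "H_sp G k = dsp G (2 * k - 2) \<times> dsp_star G (2 * k - 1)"

definition K_sp ::
  "(nat \<Rightarrow> 'm::complex_inner \<Rightarrow> 'n::complex_inner) \<Rightarrow> nat \<Rightarrow> (nat \<Rightarrow> 'm \<times> 'n) set" where
  "K_sp G n = {h. (\<forall>k\<in>{1..n + 1}. h k \<in> H_sp G k) \<and> (\<forall>k. k \<notin> {1..n + 1} \<longrightarrow> h k = 0)}"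

definition V_op ::
  "(nat \<Rightarrow> 'm::complex_inner \<Rightarrow> 'n::complex_inner) \<Rightarrow> nat \<Rightarrow>
   (nat \<Rightarrow> 'm \<times> 'n) \<Rightarrow> (nat \<Rightarrow> 'n \<times> 'm)" where
  "V_op G n h = (\<lambda>k. if k \<in> {1..n + 1} then rotation G (2 * k - 1) (h k) else 0)"

text \<open>The block \<open>rotation G (2 * k)\<close> sends the second entry of component \<open>k\<close> and the first entry
  of component \<open>k + 1\<close> to the second entry of component \<open>k\<close> and the first entry of component
  \<open>k + 1\<close>. At the two ends stand \<open>- (G 0)*\<close> and \<open>0\<close>.\<close>

definition W_op ::
  "(nat \<Rightarrow> 'm::complex_inner \<Rightarrow> 'n::complex_inner) \<Rightarrow> nat \<Rightarrow>
   (nat \<Rightarrow> 'n \<times> 'm) \<Rightarrow> (nat \<Rightarrow> 'm \<times> 'n)" where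
  "W_op G n g = (\<lambda>k. if k \<in> {1..n + 1} then
      (if k = 1 then - par_adj G 0 (fst (g 1))
       else snd (rotation G (2 * (k - 1)) (snd (g (k - 1)), fst (g k))),
       if k = n + 1 then 0
       else fst (rotation G (2 * k) (snd (g k), fst (g (k + 1)))))
     else 0)"

definition S_op ::
  "(nat \<Rightarrow> 'm::complex_inner \<Rightarrow> 'n::complex_inner) \<Rightarrow> nat \<Rightarrow>
   (nat \<Rightarrow> 'm \<times> 'n) \<Rightarrow> (nat \<Rightarrow> 'm \<times> 'n)" where
  "S_op G n h = W_op G n (V_op G n h)"

definition I_minus_zS ::
  "(nat \<Rightarrow> 'm::complex_inner \<Rightarrow> 'n::complex_inner) \<Rightarrow> nat \<Rightarrow> complex \<Rightarrow>
   (nat \<Rightarrow> 'm \<times> 'n) \<Rightarrow> (nat \<Rightarrow> 'm \<times> 'n)" where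
  "I_minus_zS G n z h = (\<lambda>k. h k - z *C S_op G n h k)"

definition R_op ::
  "(nat \<Rightarrow> 'm::complex_inner \<Rightarrow> 'n::complex_inner) \<Rightarrow> nat \<Rightarrow> complex \<Rightarrow>
   (nat \<Rightarrow> 'm \<times> 'n) \<Rightarrow> (nat \<Rightarrow> 'm \<times> 'n)" where
  "R_op G n z = the_inv_into (K_sp G n) (I_minus_zS G n z)"

text \<open>The inclusions into \<open>K_sp G n\<close> of the first and of the last summand,
  \<open>dsp G 0\<close> and \<open>dsp_star G (2 * n + 1)\<close>.\<close>

definition incl_first :: "'m::complex_inner \<Rightarrow> nat \<Rightarrow> 'm \<times> 'n::complex_inner" where
  "incl_first x = (\<lambda>k. if k = 1 then (x, 0) else 0)"

definition incl_last :: "nat \<Rightarrow> 'n::complex_inner \<Rightarrow> nat \<Rightarrow> 'm::complex_inner \<times> 'n" where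
  "incl_last n y = (\<lambda>k. if k = n + 1 then (0, y) else 0)"

definition row_first ::
  "(nat \<Rightarrow> 'm::complex_inner \<Rightarrow> 'n::complex_inner) \<Rightarrow> 'm \<times> 'n \<Rightarrow> 'n" where
  "row_first G = (\<lambda>(x, y). G 1 x + dop_star G 1 y)"

definition row_last ::
  "(nat \<Rightarrow> 'm::complex_inner \<Rightarrow> 'n::complex_inner) \<Rightarrow> nat \<Rightarrow> 'm \<times> 'n \<Rightarrow> 'm" where
  "row_last G n = (\<lambda>(x, y). dop G (2 * n + 1) x - par_adj G (2 * n + 1) y)"

text \<open>The projection of \<open>h\<close> onto the \<open>k\<close>-th summand \<open>H_sp G k\<close> is \<open>h k\<close>.\<close>

definition Theta0_fun ::
  "(nat \<Rightarrow> 'm::complex_inner \<Rightarrow> 'n::complex_inner) \<Rightarrow> nat \<Rightarrow> complex \<Rightarrow> 'm \<Rightarrow> 'n" where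
  "Theta0_fun G n z x =
     G 0 x + z *C dop_star G 0 (row_first G (R_op G n z (incl_first (dop G 0 x)) 1))"

definition A_fun ::
  "(nat \<Rightarrow> 'm::complex_inner \<Rightarrow> 'n::complex_inner) \<Rightarrow> nat \<Rightarrow> complex \<Rightarrow> 'n \<Rightarrow> 'm" where
  "A_fun G n z y = z *C row_last G n (R_op G n z (incl_last n y) (n + 1))"

definition B_fun ::
  "(nat \<Rightarrow> 'm::complex_inner \<Rightarrow> 'n::complex_inner) \<Rightarrow> nat \<Rightarrow> complex \<Rightarrow> 'm \<Rightarrow> 'm" where
  "B_fun G n z x = z *C row_last G n (R_op G n z (incl_first (dop G 0 x)) (n + 1))"

definition C_fun ::
  "(nat \<Rightarrow> 'm::complex_inner \<Rightarrow> 'n::complex_inner) \<Rightarrow> nat \<Rightarrow> complex \<Rightarrow> 'n \<Rightarrow> 'n" where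
  "C_fun G n z y = z *C dop_star G 0 (row_first G (R_op G n z (incl_last n y) 1))"

definition Q_fun ::
  "(nat \<Rightarrow> 'm::complex_inner \<Rightarrow> 'n::complex_inner) \<Rightarrow> nat \<Rightarrow> complex \<Rightarrow> 'm \<times> 'n \<Rightarrow> 'n \<times> 'm" where
  "Q_fun G n z = (\<lambda>(x, y). (Theta0_fun G n z x + C_fun G n z y, B_fun G n z x + A_fun G n z y))"

end

theory Submission
  imports Defs "HOL-Library.Function_Algebras"
begin

text \<open>One step of the Schur algorithm says that, with \<open>v = (I + z \<Gamma>\<^sub>k\<^sup>* \<Theta>\<^sub>k\<^sub>+\<^sub>1(z))\<^sup>-\<^sup>1 D\<^bsub>\<Gamma>\<^sub>k\<^esub> u\<close>,
  the elementary rotation of \<open>\<Gamma>\<^sub>k\<close> maps \<open>(u, z \<Theta>\<^sub>k\<^sub>+\<^sub>1(z) v)\<close> to \<open>(\<Theta>\<^sub>k(z) u, v)\<close>. Starting from \<open>u = x\<close> and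
  chaining \<open>2 n + 2\<close> steps, the vectors so produced, scaled by suitable powers of \<open>z\<close>, form a
  solution \<open>h\<close> of \<open>(I - z S) h = input\<close>, so \<open>Q\<^sub>n(z)\<close> maps \<open>(x, \<Theta>\<^sub>2\<^sub>n\<^sub>+\<^sub>2(z) v)\<close> to \<open>(\<Theta>(z) x, v)\<close> for some
  \<open>v\<close>; eliminating \<open>v\<close> gives the two formulas. All rotations being isometric, \<open>Q\<^sub>n\<close> is the transfer
  function of an isometric system. The energy balance of this system shows that \<open>Q\<^sub>n(z)\<close> is a
  contraction and that \<open>\<parallel>A\<^sub>n(z)\<parallel> \<le> |z|\<close>, which makes \<open>I - \<Theta>\<^sub>2\<^sub>n\<^sub>+\<^sub>2(z) A\<^sub>n(z)\<close> invertible.\<close>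

section \<open>Complex inner product spaces\<close>

text \<open>Two obstacles shape the proof. The defect operators are picked by \<open>SOME\<close>,
  so nothing can be computed with them until positive square roots are known to exist, to be unique,
  and to satisfy the intertwining relation that makes the rotations isometric. An explicit iteration
  gives all three: an operator that intertwines the data intertwines every iterate, hence the
  limits, and uniqueness follows from the resulting commutation. The spaces vary with
  \<open>k\<close> while the types do not. Operators therefore live on closed subsets of fixed
  types, and the state space sits in a function type without a norm; its resolvent is studied for an
  abstract norm function on a subspace. The vectors of the chain are only produced forwards.
  Bijectivity of \<open>I - z S\<close> then identifies the solution found with the value of the
  resolvent. The powers of \<open>z\<close> are multiplied in and never divided out, so
  \<open>z = 0\<close> is not a special case.\<close>

lemma scaleC_zero_left [simp]: "0 *C (x::'a::complex_vector) = 0"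
  using scaleR_scaleC[of 0 x] by simp

lemma scaleC_one [simp]: "1 *C (x::'a::complex_vector) = x"
  using scaleR_scaleC[of 1 x] by simp

lemma scaleC_minus_one: "(-1) *C (x::'a::complex_vector) = - x"
  using scaleR_scaleC[of "-1" x] by simp

lemma scaleC_zero_right [simp]: "a *C (0::'a::complex_vector) = 0"
  using scaleC_add_right[of a 0 0] by simp

lemma scaleC_minus_right: "a *C (- x) = - (a *C (x::'a::complex_vector))"
  using scaleC_add_right[of a x "- x"] by (simp add: eq_neg_iff_add_eq_0 add.commute)

lemma scaleC_diff_right: "a *C (x - y) = a *C x - a *C (y::'a::complex_vector)"
  using scaleC_add_right[of a x "- y"] by (simp add: scaleC_minus_right)

lemma scaleC_diff_left: "(a - b) *C x = a *C x - b *C (x::'a::complex_vector)"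
  using scaleC_add_left[of "a - b" b x] by (simp add: algebra_simps)

lemma scaleC_commute: "a *C b *C x = b *C a *C (x::'a::complex_vector)"
  by (simp add: scaleC_scaleC mult.commute)

lemma cinner_add_right: "cinner x (y + w) = cinner x y + cinner x (w::'a::complex_inner)"
  by (metis cinner_commute cinner_add_left complex_cnj_add)

lemma cinner_scaleC_right: "cinner x (a *C y) = cnj a * cinner x (y::'a::complex_inner)"
  by (metis cinner_commute cinner_scaleC_left complex_cnj_mult)

lemma cinner_minus_left: "cinner (- x) y = - cinner x (y::'a::complex_inner)"
  using cinner_scaleC_left[of "-1" x y] by (simp add: scaleC_minus_one)

lemma cinner_minus_right: "cinner x (- y) = - cinner x (y::'a::complex_inner)"
  using cinner_scaleC_right[of x "-1" y] by (simp add: scaleC_minus_one)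

lemma cinner_diff_left: "cinner (x - y) w = cinner x w - cinner y (w::'a::complex_inner)"
  using cinner_add_left[of x "- y" w] by (simp add: cinner_minus_left)

lemma cinner_diff_right: "cinner x (y - w) = cinner x y - cinner x (w::'a::complex_inner)"
  using cinner_add_right[of x y "- w"] by (simp add: cinner_minus_right)

lemma cinner_scaleR_left: "cinner (r *\<^sub>R x) y = of_real r * cinner x (y::'a::complex_inner)"
  by (simp add: scaleR_scaleC cinner_scaleC_left)

lemma cinner_scaleR_right: "cinner x (r *\<^sub>R y) = of_real r * cinner x (y::'a::complex_inner)"
  by (simp add: scaleR_scaleC cinner_scaleC_right)

lemma cinner_zero_left [simp]: "cinner 0 (y::'a::complex_inner) = 0"
  using cinner_add_left[of 0 0 y] by simp

lemma cinner_zero_right [simp]: "cinner (y::'a::complex_inner) 0 = 0"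
  using cinner_add_right[of y 0 0] by simp

lemma Re_cinner_commute: "Re (cinner x y) = Re (cinner y (x::'a::complex_inner))"
  by (subst cinner_commute) simp

lemma Re_cinner_self: "Re (cinner x x) = (norm (x::'a::complex_inner))\<^sup>2"
  by (simp add: cinner_self)

lemma norm_add_sq: "(norm (x + y))\<^sup>2 = (norm x)\<^sup>2 + 2 * Re (cinner x y) + (norm (y::'a::complex_inner))\<^sup>2"
  using Re_cinner_commute[of x y]
  by (simp flip: Re_cinner_self add: cinner_add_left cinner_add_right)

lemma norm_diff_sq: "(norm (x - y))\<^sup>2 = (norm x)\<^sup>2 - 2 * Re (cinner x y) + (norm (y::'a::complex_inner))\<^sup>2"
  using norm_add_sq[of x "- y"] by (simp add: cinner_minus_right)

lemma norm_scaleC: "norm (a *C x) = cmod a * norm (x::'a::complex_inner)"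
proof -
  have "complex_of_real ((norm (a *C x))\<^sup>2) = (a * cnj a) * complex_of_real ((norm x)\<^sup>2)"
    unfolding cinner_self[symmetric] by (simp add: cinner_scaleC_left cinner_scaleC_right)
  also have "\<dots> = complex_of_real ((cmod a * norm x)\<^sup>2)"
    by (simp add: complex_norm_square[symmetric] power_mult_distrib)
  finally have "complex_of_real ((norm (a *C x))\<^sup>2) = complex_of_real ((cmod a * norm x)\<^sup>2)" .
  then have "(norm (a *C x))\<^sup>2 = (cmod a * norm x)\<^sup>2"
    using of_real_eq_iff by blast
  then show ?thesis by (simp add: power2_eq_iff_nonneg)
qed

lemma Re_cinner_le: "Re (cinner x y) \<le> norm x * norm (y::'a::complex_inner)"
proof -
  have "(norm (x + y))\<^sup>2 \<le> (norm x + norm y)\<^sup>2"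
    by (simp add: norm_triangle_ineq power_mono)
  then show ?thesis by (simp add: norm_add_sq power2_sum)
qed

lemma cmod_cinner_le: "cmod (cinner x y) \<le> norm x * norm (y::'a::complex_inner)"
proof (cases "cinner x y = 0")
  case False
  \<comment> \<open>A unimodular factor that turns the inner product into its modulus, so that the
    bound for real parts applies.\<close>
  define a where "a = cnj (cinner x y) / cmod (cinner x y)"
  have a: "cmod a = 1" using False by (simp add: a_def norm_divide)
  have "cnj (cinner x y) * cinner x y = complex_of_real ((cmod (cinner x y))\<^sup>2)"
    unfolding complex_norm_square by (rule mult.commute)
  then have "cinner (a *C x) y = cmod (cinner x y)"
    using False by (simp add: cinner_scaleC_left a_def power2_eq_square)
  then have "cmod (cinner x y) = Re (cinner (a *C x) y)" by simp
  also have "\<dots> \<le> norm x * norm y"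
    using Re_cinner_le[of "a *C x" y] by (simp add: norm_scaleC a)
  finally show ?thesis .
qed simp

lemma tendsto_cinner_left:
  fixes y :: "'a::complex_inner"
  assumes "f \<longlonglongrightarrow> l" shows "(\<lambda>j. cinner (f j) y) \<longlonglongrightarrow> cinner l y"
proof -
  have "(\<lambda>j. norm (f j - l) * norm y) \<longlonglongrightarrow> 0"
    using assms tendsto_mult_left_zero tendsto_norm_zero LIM_zero by blast
  then have "(\<lambda>j. cinner (f j) y - cinner l y) \<longlonglongrightarrow> 0"
    by (rule Lim_null_comparison[rotated])
       (auto simp flip: cinner_diff_left intro!: always_eventually cmod_cinner_le)
  then show ?thesis by (simp add: LIM_zero_cancel)
qed

lemma tendsto_cinner_right:
  fixes y :: "'a::complex_inner"
  assumes "f \<longlonglongrightarrow> l" shows "(\<lambda>j. cinner y (f j)) \<longlonglongrightarrow> cinner y l"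
  using tendsto_cnj[OF tendsto_cinner_left[OF assms, of y]] by (simp flip: cinner_commute)

lemma scaleC_tendsto:
  fixes l :: "'a::complex_inner"
  assumes "f \<longlonglongrightarrow> l" shows "(\<lambda>j. a *C f j) \<longlonglongrightarrow> a *C l"
proof -
  have "(\<lambda>j. cmod a * norm (f j - l)) \<longlonglongrightarrow> 0"
    using assms tendsto_mult_right_zero tendsto_norm_zero LIM_zero by blast
  then have "(\<lambda>j. a *C f j - a *C l) \<longlonglongrightarrow> 0"
    by (rule Lim_null_comparison[rotated]) (auto simp flip: scaleC_diff_right simp: norm_scaleC)
  then show ?thesis by (simp add: LIM_zero_cancel)
qed

text \<open>First-variation principle: near \<open>t = 0\<close> the linear term dominates. It
  serves the minimisation in the Riesz lemma and the kernel of a positive form.\<close>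

lemma linear_term_zero_if_quadratic_nonneg:
  fixes a b :: real
  assumes "\<And>t. 0 \<le> a * t\<^sup>2 + b * t"
  shows "b = 0"
proof -
  \<comment> \<open>\<open>c\<close> is positive and \<open>a \<le> c - 1\<close>, so at
    \<open>t = - b / c\<close> the value is at most
    \<open>- (b\<^sup>2 / c\<^sup>2)\<close>.\<close>
  define c where "c = \<bar>a\<bar> + 1"
  have c: "c > 0" "a \<le> c - 1" unfolding c_def by auto
  have "0 \<le> a * (- b / c)\<^sup>2 + b * (- b / c)" by (rule assms)
  also have "\<dots> \<le> (c - 1) * (- b / c)\<^sup>2 + b * (- b / c)"
    by (intro add_right_mono mult_right_mono c) auto
  also have "\<dots> = - (b\<^sup>2 / c\<^sup>2)"
    using c(1) by (simp add: field_simps power2_eq_square)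
  finally have "b\<^sup>2 / c\<^sup>2 \<le> 0" by simp
  then show ?thesis using c(1) by (simp add: divide_le_0_iff)
qed

section \<open>Complex subspaces and linear maps between them\<close>

definition csubspace :: "'a::complex_vector set \<Rightarrow> bool" where
  "csubspace L \<longleftrightarrow> 0 \<in> L \<and> (\<forall>x\<in>L. \<forall>y\<in>L. x + y \<in> L) \<and> (\<forall>a. \<forall>x\<in>L. a *C x \<in> L)"

lemma csubspaceD:
  assumes "csubspace L"
  shows "0 \<in> L" "\<And>x y. x \<in> L \<Longrightarrow> y \<in> L \<Longrightarrow> x + y \<in> L" "\<And>a x. x \<in> L \<Longrightarrow> a *C x \<in> L"
    "\<And>x. x \<in> L \<Longrightarrow> - x \<in> L" "\<And>x y. x \<in> L \<Longrightarrow> y \<in> L \<Longrightarrow> x - y \<in> L"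
    "\<And>r x. x \<in> L \<Longrightarrow> r *\<^sub>R x \<in> L"
proof -
  show *: "0 \<in> L" "\<And>x y. x \<in> L \<Longrightarrow> y \<in> L \<Longrightarrow> x + y \<in> L" "\<And>a x. x \<in> L \<Longrightarrow> a *C x \<in> L"
    using assms by (auto simp: csubspace_def)
  show **: "\<And>x. x \<in> L \<Longrightarrow> - x \<in> L" using *(3)[of _ "-1"] by (simp add: scaleC_minus_one)
  show "\<And>x y. x \<in> L \<Longrightarrow> y \<in> L \<Longrightarrow> x - y \<in> L"
    using *(2) ** by (metis diff_conv_add_uminus)
  show "\<And>r x. x \<in> L \<Longrightarrow> r *\<^sub>R x \<in> L" using *(3) by (simp add: scaleR_scaleC)
qed

text \<open>The algebraic part of \<open>bounded_op\<close>. No norm is involved, so it also covers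
  maps into and out of the state space.\<close>

definition clinear_on :: "'a::complex_vector set \<Rightarrow> 'b::complex_vector set \<Rightarrow> ('a \<Rightarrow> 'b) \<Rightarrow> bool" where
  "clinear_on L K T \<longleftrightarrow> (\<forall>x\<in>L. T x \<in> K) \<and> (\<forall>x\<in>L. \<forall>y\<in>L. T (x + y) = T x + T y) \<and>
     (\<forall>a. \<forall>x\<in>L. T (a *C x) = a *C T x)"

lemma clinear_onD:
  assumes "clinear_on L K T"
  shows "\<And>x. x \<in> L \<Longrightarrow> T x \<in> K" "\<And>x y. x \<in> L \<Longrightarrow> y \<in> L \<Longrightarrow> T (x + y) = T x + T y"
    "\<And>a x. x \<in> L \<Longrightarrow> T (a *C x) = a *C T x" "\<And>r x. x \<in> L \<Longrightarrow> T (r *\<^sub>R x) = r *\<^sub>R T x"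
  using assms by (auto simp: clinear_on_def scaleR_scaleC)

lemma clinear_on_zero: "csubspace L \<Longrightarrow> clinear_on L K T \<Longrightarrow> T 0 = 0"
  using clinear_onD(3)[of L K T 0 0] csubspaceD(1)[of L] by simp

lemma clinear_on_minus: "clinear_on L K T \<Longrightarrow> x \<in> L \<Longrightarrow> T (- x) = - T x"
  using clinear_onD(3)[of L K T x "-1"] by (simp add: scaleC_minus_one)

lemma clinear_on_diff:
  "csubspace L \<Longrightarrow> clinear_on L K T \<Longrightarrow> x \<in> L \<Longrightarrow> y \<in> L \<Longrightarrow> T (x - y) = T x - T y"
  using clinear_onD(2)[of L K T x "- y"] by (simp add: clinear_on_minus csubspaceD(4))

lemma bounded_op_iff:
  "bounded_op L K T \<longleftrightarrow> clinear_on L K T \<and> (\<exists>B. \<forall>x\<in>L. norm (T x) \<le> B * norm x)"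
  by (auto simp: bounded_op_def clinear_on_def)

lemma bounded_op_clinear_on: "bounded_op L K T \<Longrightarrow> clinear_on L K T"
  by (simp add: bounded_op_iff)

lemma clinear_on_compose: "clinear_on L K T \<Longrightarrow> clinear_on K M S \<Longrightarrow> clinear_on L M (\<lambda>x. S (T x))"
  by (simp add: clinear_on_def)

lemma csubspace_image:
  assumes "csubspace L" "clinear_on L K T"
  shows "csubspace (T ` L)"
  unfolding csubspace_def
proof (intro conjI ballI allI)
  show "0 \<in> T ` L"
    by (metis assms clinear_on_zero csubspaceD(1) imageI)
  show "u + v \<in> T ` L" if "u \<in> T ` L" "v \<in> T ` L" for u v
    using that by (auto simp flip: clinear_onD(2)[OF assms(2)] intro: csubspaceD[OF assms(1)])
  show "a *C u \<in> T ` L" if "u \<in> T ` L" for a u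
    using that by (auto simp flip: clinear_onD(3)[OF assms(2)] intro: csubspaceD[OF assms(1)])
qed

lemma csubspace_closure:
  fixes L :: "'a::complex_inner set"
  assumes "csubspace L" shows "csubspace (closure L)"
  unfolding csubspace_def
proof (intro conjI ballI allI)
  show "0 \<in> closure L" using assms csubspaceD(1) closure_subset by blast
next
  fix x y assume "x \<in> closure L" "y \<in> closure L"
  then obtain f g where "\<forall>n. f n \<in> L" "f \<longlonglongrightarrow> x" "\<forall>n. g n \<in> L" "g \<longlonglongrightarrow> y"
    by (meson closure_sequential)
  then show "x + y \<in> closure L"
    unfolding closure_sequential using csubspaceD(2)[OF assms]
    by (intro exI[of _ "\<lambda>n. f n + g n"]) (auto intro: tendsto_add)
next
  fix a x assume "x \<in> closure L"
  then obtain f where "\<forall>n. f n \<in> L" "f \<longlonglongrightarrow> x" by (meson closure_sequential)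
  then show "a *C x \<in> closure L"
    unfolding closure_sequential using csubspaceD(3)[OF assms]
    by (intro exI[of _ "\<lambda>n. a *C f n"]) (auto intro: scaleC_tendsto)
qed

lemma bounded_op_tendsto:
  assumes "csubspace L" "bounded_op L K T" "\<And>j. f j \<in> L" "l \<in> L" "f \<longlonglongrightarrow> l"
  shows "(\<lambda>j. T (f j)) \<longlonglongrightarrow> T l"
proof -
  obtain B where B: "\<And>x. x \<in> L \<Longrightarrow> norm (T x) \<le> B * norm x"
    using assms(2) by (auto simp: bounded_op_iff)
  have "(\<lambda>j. B * norm (f j - l)) \<longlonglongrightarrow> 0"
    using assms(5) tendsto_mult_right_zero tendsto_norm_zero LIM_zero by blast
  then have "(\<lambda>j. T (f j) - T l) \<longlonglongrightarrow> 0"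
  proof (rule Lim_null_comparison[rotated])
    show "\<forall>\<^sub>F j in sequentially. norm (T (f j) - T l) \<le> B * norm (f j - l)"
      using B[of "f _ - l"] clinear_on_diff[OF assms(1) bounded_op_clinear_on[OF assms(2)] assms(3,4)]
      by (auto simp: csubspaceD(5)[OF assms(1)] assms(3,4))
  qed
  then show ?thesis by (simp add: LIM_zero_cancel)
qed

section \<open>Adjoints\<close>

definition chilbert :: "'a::complex_inner set \<Rightarrow> bool" where
  "chilbert L \<longleftrightarrow> csubspace L \<and> closed L"

text \<open>Variational proof: the representing vector is the minimiser of \<open>J\<close>, found
  as the limit of a minimising sequence.\<close>

lemma riesz_representation:
  fixes L :: "'a::complex_hilbert set"
  assumes L: "chilbert L"
    and add: "\<And>x y. x \<in> L \<Longrightarrow> y \<in> L \<Longrightarrow> f (x + y) = f x + f y"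
    and scale: "\<And>a x. x \<in> L \<Longrightarrow> f (a *C x) = a * f x"
    and bd: "\<And>x. x \<in> L \<Longrightarrow> cmod (f x) \<le> B * norm x"
  shows "\<exists>x\<in>L. \<forall>v\<in>L. f v = cinner v x"
proof -
  have sub: "csubspace L" and cl: "closed L" using L by (auto simp: chilbert_def)
  note [simp, intro] = csubspaceD[OF sub]
  have scaleR: "f (r *\<^sub>R x) = of_real r * f x" if "x \<in> L" for r x
    using that by (simp add: scaleR_scaleC scale)
  \<comment> \<open>If \<open>f\<close> is represented by \<open>x\<close>, then \<open>J v\<close>
    is the squared distance from \<open>v\<close> to \<open>x\<close>, minus the constant
    \<open>(norm x)\<^sup>2\<close>.\<close>
  define J where "J v = (norm v)\<^sup>2 - 2 * Re (f v)" for v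
  have lb: "- B\<^sup>2 \<le> J v" if "v \<in> L" for v
  proof -
    have "Re (f v) \<le> B * norm v" using bd[OF that] complex_Re_le_cmod order_trans by blast
    moreover have "0 \<le> (norm v - B)\<^sup>2" by simp
    ultimately show ?thesis unfolding J_def power2_diff by (simp add: algebra_simps)
  qed
  then have bdd: "bdd_below (J ` L)" by (auto intro!: bdd_belowI2)
  define m where "m = Inf (J ` L)"
  have m: "m \<le> J v" if "v \<in> L" for v unfolding m_def using that bdd by (simp add: cINF_lower)
  have ne: "J ` L \<noteq> {}" using csubspaceD(1)[OF sub] by blast
  have "\<exists>v\<in>L. J v < m + inverse (Suc j)" for j
    using cInf_lessD[OF ne, of "m + inverse (Suc j)"] unfolding m_def by auto
  then obtain v where v: "\<And>j. v j \<in> L" "\<And>j. J (v j) < m + inverse (Suc j)" by metis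
  \<comment> \<open>Parallelogram law: the linear parts of \<open>J\<close> cancel. Since the
    midpoint has value at least \<open>m\<close>, a minimising sequence is Cauchy.\<close>
  have par: "(norm (x - y))\<^sup>2 = 2 * J x + 2 * J y - 4 * J ((1/2) *\<^sub>R (x + y))" if "x \<in> L" "y \<in> L" for x y
    using that unfolding J_def scaleR[OF csubspaceD(2)[OF sub that]] add[OF that]
    by (simp add: norm_diff_sq norm_add_sq power_mult_distrib power_divide
        cinner_scaleR_left cinner_scaleR_right field_simps)
  have dist: "(norm (v i - v j))\<^sup>2 \<le> 2 * inverse (Suc i) + 2 * inverse (Suc j)" for i j
    using par[OF v(1) v(1), of i j] v(2)[of i] v(2)[of j] m[of "(1/2) *\<^sub>R (v i + v j)"] v(1)
    by auto
  have "Cauchy v"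
  proof (rule metric_CauchyI)
    fix e :: real assume "0 < e"
    then obtain M where M: "inverse (Suc M) < e\<^sup>2 / 4"
      using reals_Archimedean[of "e\<^sup>2 / 4"] by auto
    show "\<exists>M. \<forall>i\<ge>M. \<forall>j\<ge>M. dist (v i) (v j) < e"
    proof (intro exI allI impI)
      fix i j assume "M \<le> i" "M \<le> j"
      then have "inverse (Suc i) \<le> inverse (real (Suc M))" "inverse (Suc j) \<le> inverse (real (Suc M))"
        by (auto intro!: le_imp_inverse_le simp del: of_nat_Suc)
      then have "(norm (v i - v j))\<^sup>2 < e\<^sup>2" using dist[of i j] M by linarith
      then show "dist (v i) (v j) < e"
        using \<open>0 < e\<close> by (simp add: dist_norm power_less_imp_less_base)
    qed
  qed
  then obtain x where x: "v \<longlonglongrightarrow> x" using Cauchy_convergent convergent_def by blast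
  have xL: "x \<in> L" using cl x v(1) closed_sequentially by blast
  have "(\<lambda>j. f (v j) - f x) \<longlonglongrightarrow> 0"
  proof (rule Lim_null_comparison)
    show "(\<lambda>j. B * norm (v j - x)) \<longlonglongrightarrow> 0"
      using x tendsto_mult_right_zero tendsto_norm_zero LIM_zero by blast
    have "f (v j - x) = f (v j) - f x" for j
      using add[of "v j - x" x] v(1) xL by simp
    then show "\<forall>\<^sub>F j in sequentially. norm (f (v j) - f x) \<le> B * norm (v j - x)"
      using bd[of "v _ - x"] v(1) xL by (auto intro!: always_eventually)
  qed
  then have "(\<lambda>j. J (v j)) \<longlonglongrightarrow> J x"
    unfolding J_def by (intro tendsto_intros x) (simp add: LIM_zero_cancel)
  moreover have "(\<lambda>j. m + inverse (Suc j)) \<longlonglongrightarrow> m + 0"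
    by (intro tendsto_intros LIMSEQ_inverse_real_of_nat)
  ultimately have "J x \<le> m"
    using LIMSEQ_le[of "\<lambda>j. J (v j)" "J x" "\<lambda>j. m + inverse (Suc j)" "m + 0"] v(2)
    by (auto intro: less_imp_le)
  then have min: "J x \<le> J w" if "w \<in> L" for w using m[OF that] by simp
  \<comment> \<open>First variation of \<open>J\<close> at the minimiser in the direction
    \<open>w\<close>.\<close>
  have re: "Re (f w) = Re (cinner w x)" if "w \<in> L" for w
  proof -
    have "0 \<le> (norm w)\<^sup>2 * t\<^sup>2 + 2 * (Re (cinner w x) - Re (f w)) * t" for t
    proof -
      have "J (x + t *\<^sub>R w) = J x + (norm w)\<^sup>2 * t\<^sup>2 + 2 * (Re (cinner w x) - Re (f w)) * t"
        unfolding J_def using that xL Re_cinner_commute[of w x]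
        by (simp add: norm_add_sq add scaleR cinner_scaleR_right power_mult_distrib algebra_simps)
      then show ?thesis using min[of "x + t *\<^sub>R w"] that xL by simp
    qed
    then show ?thesis using linear_term_zero_if_quadratic_nonneg by fastforce
  qed
  \<comment> \<open>Replacing \<open>w\<close> by \<open>\<i> *C w\<close> turns the equality of
    real parts into that of imaginary parts.\<close>
  have "f w = cinner w x" if "w \<in> L" for w
    using re[OF that] re[of "\<i> *C w"] that
    by (simp add: complex_eq_iff scale cinner_scaleC_left)
  then show ?thesis using xL by blast
qed

locale contraction =
  fixes L :: "'a::complex_hilbert set" and K :: "'b::complex_hilbert set" and T :: "'a \<Rightarrow> 'b"
  assumes L: "chilbert L" and K: "chilbert K" and op: "bounded_op L K T"
    and contr: "x \<in> L \<Longrightarrow> norm (T x) \<le> norm x"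
begin

lemma subL: "csubspace L" and subK: "csubspace K" and clL: "closed L"
  using L K by (auto simp: chilbert_def)

lemma lin: "clinear_on L K T" by (simp add: bounded_op_clinear_on op)

lemma adjoint_unique:
  assumes "x \<in> L" "x' \<in> L" "\<forall>v\<in>L. cinner v x = cinner v x'"
  shows "x = x'"
proof -
  have "cinner (x - x') (x - x') = 0"
    using assms by (simp add: cinner_diff_right csubspaceD(5)[OF subL])
  then show ?thesis by (simp add: cinner_self)
qed

lemma adjoint_ex1:
  assumes "y \<in> K"
  shows "\<exists>!x. x \<in> L \<and> (\<forall>v\<in>L. cinner (T v) y = cinner v x)"
proof -
  have "\<exists>x\<in>L. \<forall>v\<in>L. cinner (T v) y = cinner v x"
  proof (rule riesz_representation[OF L, where B = "norm y"])
    fix x assume "x \<in> L"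
    have "cmod (cinner (T x) y) \<le> norm (T x) * norm y" by (rule cmod_cinner_le)
    also have "\<dots> \<le> norm x * norm y" by (simp add: contr \<open>x \<in> L\<close> mult_right_mono)
    finally show "cmod (cinner (T x) y) \<le> norm y * norm x" by (simp add: mult.commute)
  qed (simp_all add: clinear_onD[OF lin] cinner_add_left cinner_scaleC_left)
  then show ?thesis using adjoint_unique by (metis (no_types, lifting))
qed

abbreviation "Tadj \<equiv> adjoint_on L T"

lemma adj_in: "y \<in> K \<Longrightarrow> Tadj y \<in> L"
  and adj: "y \<in> K \<Longrightarrow> v \<in> L \<Longrightarrow> cinner (T v) y = cinner v (Tadj y)"
  using theI'[OF adjoint_ex1, of y] unfolding adjoint_on_def by auto

lemma adj_eqI: "y \<in> K \<Longrightarrow> x \<in> L \<Longrightarrow> (\<And>v. v \<in> L \<Longrightarrow> cinner (T v) y = cinner v x) \<Longrightarrow> Tadj y = x"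
  using adjoint_unique[OF adj_in, of y x] adj by simp

text \<open>Phrased as membership in the locale, so that every fact about \<open>T\<close> passes to
  its adjoint by interpretation.\<close>

lemma adj_contraction: "contraction K L Tadj"
proof
  have le: "norm (Tadj y) \<le> norm y" if "y \<in> K" for y
  proof (cases "Tadj y = 0")
    case False
    have "(norm (Tadj y))\<^sup>2 = Re (cinner (T (Tadj y)) y)"
      using that by (simp add: adj adj_in Re_cinner_self)
    also have "\<dots> \<le> norm (T (Tadj y)) * norm y" by (rule Re_cinner_le)
    also have "\<dots> \<le> norm (Tadj y) * norm y"
      by (intro mult_right_mono) (simp_all add: contr adj_in that)
    finally show ?thesis using False by (simp add: power2_eq_square)
  qed simp
  have "clinear_on K L Tadj"
    unfolding clinear_on_def
    by (auto intro!: adj_eqI simp: adj_in adj csubspaceD[OF subL] csubspaceD[OF subK]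
        cinner_add_right cinner_scaleC_right)
  then show "bounded_op K L Tadj"
    unfolding bounded_op_iff using le by (metis mult_1)
  show "\<And>y. y \<in> K \<Longrightarrow> norm (Tadj y) \<le> norm y" by (rule le)
  show "chilbert K" by (rule K)
  show "chilbert L" by (rule L)
qed

lemma adj': "y \<in> K \<Longrightarrow> v \<in> L \<Longrightarrow> cinner (Tadj y) v = cinner y (T v)"
  using adj[of y v] cinner_commute[of "Tadj y" v] cinner_commute[of y "T v"] by simp

lemma adj_adj: "x \<in> L \<Longrightarrow> adjoint_on K Tadj x = T x"
  by (rule contraction.adj_eqI[OF adj_contraction]) (simp_all add: adj' clinear_onD(1)[OF lin])

end

section \<open>Square roots and defect operators\<close>

text \<open>With \<open>Y = I - R\<close>, the equation \<open>R\<^sup>2 = I - C\<close> reads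
  \<open>Y = (C + Y\<^sup>2) / 2\<close>. This is its fixed-point iteration started at 0, written on
  vectors.\<close>

primrec sqrt_iter :: "('a::complex_inner \<Rightarrow> 'a) \<Rightarrow> nat \<Rightarrow> 'a \<Rightarrow> 'a" where
  "sqrt_iter C 0 x = 0"
| "sqrt_iter C (Suc j) x = (1/2) *\<^sub>R (C x + sqrt_iter C j (sqrt_iter C j x))"

text \<open>The scalar iteration for \<open>C = 1\<close>; it dominates the operator iteration, differences
  included, and so carries the convergence.\<close>

primrec scalar_iter :: "nat \<Rightarrow> real" where
  "scalar_iter 0 = 0"
| "scalar_iter (Suc j) = (1 + (scalar_iter j)\<^sup>2) / 2"

lemma scalar_iter_bounds: "0 \<le> scalar_iter j \<and> scalar_iter j \<le> 1 \<and> scalar_iter j \<le> scalar_iter (Suc j)"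
proof (induction j)
  case (Suc j)
  then have "(scalar_iter j)\<^sup>2 \<le> 1" by (simp add: power_le_one)
  moreover have "(scalar_iter j)\<^sup>2 \<le> (scalar_iter (Suc j))\<^sup>2"
    using Suc by (intro power_mono) auto
  ultimately show ?case by simp
qed simp

lemma scalar_iter_Cauchy: "Cauchy scalar_iter"
proof -
  have "incseq scalar_iter" using scalar_iter_bounds by (intro incseq_SucI) blast
  then show ?thesis
    using incseq_convergent[of scalar_iter 1] scalar_iter_bounds LIMSEQ_imp_Cauchy by metis
qed

text \<open>The square root of \<open>I - C\<close>. No subspace enters, so roots on two different
  spaces can be compared through an operator between them.\<close>

definition sqrt_lim :: "('a::complex_inner \<Rightarrow> 'a) \<Rightarrow> 'a \<Rightarrow> 'a" where
  "sqrt_lim C x = x - lim (\<lambda>j. sqrt_iter C j x)"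

locale symmetric_contraction = contraction L L C for L :: "'a::complex_hilbert set" and C +
  assumes sym: "x \<in> L \<Longrightarrow> y \<in> L \<Longrightarrow> cinner (C x) y = cinner x (C y)"
begin

abbreviation "it \<equiv> sqrt_iter C"

lemma it_lin: "clinear_on L L (it j)"
proof (induction j)
  case 0
  show ?case by (simp add: clinear_on_def csubspaceD[OF subL])
next
  case (Suc j)
  show ?case
    by (auto simp: clinear_on_def csubspaceD[OF subL] clinear_onD[OF lin] clinear_onD[OF Suc]
        scaleC_add_right scaleR_add_right scaleR_scaleC scaleC_commute)
qed

lemma it_in: "x \<in> L \<Longrightarrow> it j x \<in> L" by (rule clinear_onD(1)[OF it_lin])

lemma it_norm: "x \<in> L \<Longrightarrow> norm (it j x) \<le> scalar_iter j * norm x"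
proof (induction j arbitrary: x)
  case (Suc j)
  have "norm (it j (it j x)) \<le> scalar_iter j * (scalar_iter j * norm x)"
    using Suc.IH[OF it_in[OF Suc.prems]] Suc.IH[OF Suc.prems] scalar_iter_bounds[of j]
    by (meson mult_left_mono order_trans)
  then have "norm (C x + it j (it j x)) \<le> norm x + scalar_iter j * (scalar_iter j * norm x)"
    using contr[OF Suc.prems] norm_triangle_ineq[of "C x" "it j (it j x)"] by linarith
  then show ?case
    unfolding sqrt_iter.simps norm_scaleR by (simp add: power2_eq_square distrib_right)
qed simp

lemma it_norm_le: "x \<in> L \<Longrightarrow> norm (it j x) \<le> norm x"
  using it_norm[of x j] scalar_iter_bounds[of j] mult_left_le_one_le[of "norm x" "scalar_iter j"]
  by simp

text \<open>For consecutive iterates \<open>U\<close> and \<open>V\<close>, the difference of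
  squares is split as \<open>(U - V) U + V (U - V)\<close>. The two bounds add up to the same
  splitting of \<open>b\<^sup>2 - a\<^sup>2\<close> for the scalar iteration.\<close>

lemma it_step: "x \<in> L \<Longrightarrow> norm (it (Suc j) x - it j x) \<le> (scalar_iter (Suc j) - scalar_iter j) * norm x"
proof (induction j arbitrary: x)
  case 0
  then show ?case using contr by simp
next
  case (Suc j)
  define a b where "a = scalar_iter j" and "b = scalar_iter (Suc j)"
  have ab: "0 \<le> a" "a \<le> b" using scalar_iter_bounds[of j] by (auto simp: a_def b_def)
  define u v where "u = it (Suc j) x" and "v = it j x"
  have uL: "u \<in> L" and vL: "v \<in> L" unfolding u_def v_def by (rule it_in[OF Suc.prems])+
  have "it (Suc (Suc j)) x - it (Suc j) x = (1/2) *\<^sub>R (it (Suc j) u - it j v)"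
    unfolding sqrt_iter.simps(2)[of C "Suc j"] unfolding sqrt_iter.simps(2)[of C j x] u_def v_def
    by (simp add: algebra_simps)
  also have "it (Suc j) u - it j v = (it (Suc j) u - it j u) + it j (u - v)"
    by (simp add: clinear_on_diff[OF subL it_lin uL vL])
  finally have "norm (it (Suc (Suc j)) x - it (Suc j) x)
      \<le> (norm (it (Suc j) u - it j u) + norm (it j (u - v))) / 2"
    using norm_triangle_ineq[of "it (Suc j) u - it j u" "it j (u - v)"]
    by (simp del: sqrt_iter.simps)
  moreover have "norm (it (Suc j) u - it j u) \<le> (b - a) * (b * norm x)"
    using Suc.IH[OF uL] it_norm[OF Suc.prems, of "Suc j"] ab
    unfolding a_def[symmetric] b_def[symmetric] u_def[symmetric]
    by (meson diff_ge_0_iff_ge mult_left_mono order_trans)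
  moreover have "norm (it j (u - v)) \<le> a * ((b - a) * norm x)"
    using Suc.IH[OF Suc.prems] it_norm[OF csubspaceD(5)[OF subL uL vL], of j] ab
    unfolding a_def[symmetric] b_def[symmetric] u_def[symmetric] v_def[symmetric]
    by (meson mult_left_mono order_trans)
  ultimately have "norm (it (Suc (Suc j)) x - it (Suc j) x)
      \<le> ((b - a) * (b * norm x) + a * ((b - a) * norm x)) / 2"
    by (meson add_mono divide_right_mono order_trans zero_le_numeral)
  also have "\<dots> = ((1 + b\<^sup>2) / 2 - (1 + a\<^sup>2) / 2) * norm x"
    by (simp add: power2_eq_square algebra_simps diff_divide_distrib add_divide_distrib)
  finally show ?case by (simp add: a_def b_def)
qed

lemma it_diff:
  assumes "x \<in> L" "i \<le> j"
  shows "norm (it j x - it i x) \<le> (scalar_iter j - scalar_iter i) * norm x"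
  using assms(2)
proof (induction j rule: dec_induct)
  case (step j)
  have "norm (it (Suc j) x - it i x) \<le> norm (it (Suc j) x - it j x) + norm (it j x - it i x)"
    using norm_triangle_ineq[of "it (Suc j) x - it j x" "it j x - it i x"] by simp
  with step.IH it_step[OF assms(1), of j] show ?case
    by (simp add: algebra_simps del: sqrt_iter.simps scalar_iter.simps)
qed simp

lemma it_convergent:
  assumes "x \<in> L"
  shows "convergent (\<lambda>j. it j x)"
proof -
  have "Cauchy (\<lambda>j. it j x)"
  proof (rule metric_CauchyI)
    fix e :: real assume e: "0 < e"
    \<comment> \<open>Adding 1 to \<open>norm x\<close> keeps the divisor positive when
      \<open>x = 0\<close>.\<close>
    then obtain M where M: "\<And>i j. M \<le> i \<Longrightarrow> M \<le> j \<Longrightarrow> dist (scalar_iter i) (scalar_iter j) < e / (norm x + 1)"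
      using metric_CauchyD[OF scalar_iter_Cauchy, of "e / (norm x + 1)"]
      by (auto simp: add_nonneg_pos)
    have less: "dist (it i x) (it j x) < e" if "M \<le> i" "i \<le> j" for i j
    proof -
      have "norm (it j x - it i x) \<le> \<bar>scalar_iter i - scalar_iter j\<bar> * (norm x + 1)"
        using it_diff[OF assms that(2)]
        by (smt (verit, best) mult_mono norm_ge_zero)
      also have "\<dots> < e"
        using M[of i j] that by (simp add: dist_real_def pos_less_divide_eq add_nonneg_pos)
      finally show ?thesis by (simp add: dist_norm norm_minus_commute)
    qed
    show "\<exists>M. \<forall>i\<ge>M. \<forall>j\<ge>M. dist (it i x) (it j x) < e"
      using less by (metis dist_commute linear)
  qed
  then show ?thesis by (rule Cauchy_convergent)
qed

definition "yl x = lim (\<lambda>j. it j x)"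

lemma it_lim: "x \<in> L \<Longrightarrow> (\<lambda>j. it j x) \<longlonglongrightarrow> yl x"
  unfolding yl_def using it_convergent by (simp add: convergent_LIMSEQ_iff)

lemma yl_in: "x \<in> L \<Longrightarrow> yl x \<in> L"
  using closed_sequentially[OF clL, of "\<lambda>j. it j x"] it_lim it_in by blast

lemma yl_norm: "x \<in> L \<Longrightarrow> norm (yl x) \<le> norm x"
  by (rule LIMSEQ_le_const2[OF tendsto_norm[OF it_lim]]) (auto intro: it_norm_le)

lemma yl_lin: "clinear_on L L yl"
  unfolding clinear_on_def
proof (intro conjI ballI allI)
  show "yl x \<in> L" if "x \<in> L" for x using that by (rule yl_in)
  show "yl (x + y) = yl x + yl y" if "x \<in> L" "y \<in> L" for x y
    using that
    by (intro LIMSEQ_unique[OF it_lim])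
       (auto simp: clinear_onD[OF it_lin] csubspaceD[OF subL] intro!: tendsto_add it_lim)
  show "yl (a *C x) = a *C yl x" if "x \<in> L" for a x
    using that
    by (intro LIMSEQ_unique[OF it_lim])
       (auto simp: clinear_onD[OF it_lin] csubspaceD[OF subL] intro!: scaleC_tendsto it_lim)
qed

text \<open>In \<open>it j (it j x)\<close> both indices move at once. The uniform bound on the
  iterates lets the inner vector be replaced by its limit before the outer limit is taken.\<close>

lemma yl_fixpoint:
  assumes "x \<in> L" shows "yl x = (1/2) *\<^sub>R (C x + yl (yl x))"
proof -
  have "(\<lambda>j. it j (it j x - yl x)) \<longlonglongrightarrow> 0"
  proof (rule Lim_null_comparison)
    show "(\<lambda>j. norm (it j x - yl x)) \<longlonglongrightarrow> 0"
      using it_lim[OF assms] LIM_zero tendsto_norm_zero by blast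
    show "\<forall>\<^sub>F j in sequentially. norm (it j (it j x - yl x)) \<le> norm (it j x - yl x)"
      using assms by (intro always_eventually allI it_norm_le csubspaceD(5)[OF subL] it_in yl_in)
  qed
  then have "(\<lambda>j. it j (it j x - yl x) + it j (yl x)) \<longlonglongrightarrow> 0 + yl (yl x)"
    by (intro tendsto_add it_lim yl_in assms)
  then have "(\<lambda>j. it j (it j x)) \<longlonglongrightarrow> yl (yl x)"
    by (simp add: clinear_on_diff[OF subL it_lin it_in[OF assms] yl_in[OF assms]])
  then have "(\<lambda>j. it (Suc j) x) \<longlonglongrightarrow> (1/2) *\<^sub>R (C x + yl (yl x))"
    unfolding sqrt_iter.simps by (intro tendsto_intros)
  then show ?thesis
    using LIMSEQ_Suc[OF it_lim[OF assms]] LIMSEQ_unique by blast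
qed

lemma it_sym: "x \<in> L \<Longrightarrow> y \<in> L \<Longrightarrow> cinner (it j x) y = cinner x (it j y)"
  by (induction j arbitrary: x y)
     (simp_all add: cinner_scaleR_left cinner_scaleR_right cinner_add_left cinner_add_right sym it_in)

abbreviation "rt \<equiv> sqrt_lim C"

lemma rt_eq: "rt x = x - yl x" by (simp add: sqrt_lim_def yl_def)

lemma rt_in: "x \<in> L \<Longrightarrow> rt x \<in> L"
  by (simp add: rt_eq csubspaceD[OF subL] yl_in)

lemma rt_sym:
  assumes "x \<in> L" "y \<in> L" shows "cinner (rt x) y = cinner x (rt y)"
proof -
  have "cinner (yl x) y = cinner x (yl y)"
    using LIMSEQ_unique[OF tendsto_cinner_left[OF it_lim[OF assms(1)], of y], of "cinner x (yl y)"]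
      tendsto_cinner_right[OF it_lim[OF assms(2)], of x] by (simp add: it_sym assms)
  then show ?thesis by (simp add: rt_eq cinner_diff_left cinner_diff_right)
qed

lemma rt_square: "x \<in> L \<Longrightarrow> rt (rt x) = x - C x"
  using arg_cong[OF yl_fixpoint[of x], of "\<lambda>v. 2 *\<^sub>R v"]
  by (simp add: rt_eq clinear_on_diff[OF subL yl_lin] yl_in scaleR_2 algebra_simps)

text \<open>Symmetry makes the form real, and \<open>yl\<close> being a contraction makes that of
  \<open>I - yl\<close> nonnegative.\<close>

lemma rt_positive: "positive_op L rt"
  unfolding positive_op_def
proof (intro conjI ballI)
  have "clinear_on L L rt"
    unfolding rt_eq clinear_on_def
    by (auto simp: clinear_onD[OF yl_lin] csubspaceD[OF subL] scaleC_diff_right)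
  moreover have "norm (rt x) \<le> 2 * norm x" if "x \<in> L" for x
    unfolding rt_eq using yl_norm[OF that] norm_triangle_ineq4[of x "yl x"] by linarith
  ultimately show "bounded_op L L rt" unfolding bounded_op_iff by blast
next
  fix x assume x: "x \<in> L"
  have "cinner (rt x) x = cnj (cinner (rt x) x)"
    using rt_sym[OF x x] cinner_commute[of x "rt x"] by simp
  then have "Im (cinner (rt x) x) = 0" by (metis complex_cnj_cancel_iff Reals_cnj_iff complex_is_Real_iff)
  moreover have "Re (cinner (yl x) x) \<le> norm x * norm x"
    using Re_cinner_le[of "yl x" x] yl_norm[OF x] by (meson mult_right_mono norm_ge_zero order_trans)
  then have "0 \<le> Re (cinner (rt x) x)"
    by (simp add: rt_eq cinner_diff_left Re_cinner_self power2_eq_square)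
  ultimately show "cinner (rt x) x \<in> \<real>\<^sub>\<ge>\<^sub>0" by (simp add: complex_nonneg_Reals_iff)
qed

end

text \<open>Every iterate is a polynomial in \<open>C\<close>, so \<open>X\<close> intertwines the
  iterates, and by continuity the limits. Used with \<open>L = K\<close> for uniqueness of the root
  and with an adjoint as \<open>X\<close> for the defect operators.\<close>

lemma sqrt_lim_intertwine:
  assumes C: "symmetric_contraction L C" and C': "symmetric_contraction K C'"
    and X: "bounded_op L K X" and XC: "\<And>x. x \<in> L \<Longrightarrow> X (C x) = C' (X x)"
    and x: "x \<in> L"
  shows "X (sqrt_lim C x) = sqrt_lim C' (X x)"
proof -
  interpret C: symmetric_contraction L C by (rule C)
  interpret C': symmetric_contraction K C' by (rule C')
  note Xl = clinear_onD[OF bounded_op_clinear_on[OF X]]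
  have "X (C.it j x) = C'.it j (X x)" if "x \<in> L" for j x
    using that
    by (induction j arbitrary: x)
       (simp_all add: clinear_on_zero[OF C.subL bounded_op_clinear_on[OF X]] Xl C.it_in XC
         csubspaceD[OF C.subL] clinear_onD[OF C.lin])
  then have "(\<lambda>j. C'.it j (X x)) \<longlonglongrightarrow> X (C.yl x)"
    using bounded_op_tendsto[OF C.subL X C.it_in[OF x] C.yl_in[OF x] C.it_lim[OF x]] x by simp
  then have "X (C.yl x) = C'.yl (X x)"
    using LIMSEQ_unique C'.it_lim[OF Xl(1)[OF x]] by blast
  then show ?thesis
    by (simp add: C.rt_eq C'.rt_eq clinear_on_diff[OF C.subL bounded_op_clinear_on[OF X] x C.yl_in[OF x]])
qed

section \<open>Positive operators and uniqueness of the square root\<close>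

lemma positive_op_sym:
  assumes L: "csubspace L" and R: "positive_op L R" and x: "x \<in> L" and y: "y \<in> L"
  shows "cinner (R x) y = cinner x (R y)"
proof -
  have lin: "clinear_on L L R" using R by (simp add: positive_op_def bounded_op_iff)
  note [simp] = clinear_onD[OF lin] csubspaceD[OF L]
  have Im: "Im (cinner (R w) w) = 0" if "w \<in> L" for w
    using R that by (auto simp: positive_op_def complex_nonneg_Reals_iff)
  \<comment> \<open>Polarisation: the form is real at \<open>x + y\<close> here, and at
    \<open>\<i> *C x + y\<close> in the next step.\<close>
  have 1: "Im (cinner (R x) y) + Im (cinner (R y) x) = 0"
    using Im[of "x + y"] Im[of x] Im[of y] x y by (simp add: cinner_add_left cinner_add_right)
  have 2: "Re (cinner (R x) y) = Re (cinner (R y) x)"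
    using Im[of "\<i> *C x + y"] Im[of x] Im[of y] x y
    by (simp add: cinner_add_left cinner_add_right cinner_scaleC_left cinner_scaleC_right)
  show ?thesis
    using 1 2 cinner_commute[of x "R y"] by (simp add: complex_eq_iff)
qed

text \<open>The nonnegative form, restricted to the line through \<open>y\<close> in the direction
  \<open>R y\<close>, has linear coefficient \<open>2 * (norm (R y))\<^sup>2\<close>.\<close>

lemma positive_op_zero:
  assumes L: "csubspace L" and R: "positive_op L R" and y: "y \<in> L" and z: "cinner (R y) y = 0"
  shows "R y = 0"
proof -
  have lin: "clinear_on L L R" using R by (simp add: positive_op_def bounded_op_iff)
  note [simp] = clinear_onD[OF lin] csubspaceD[OF L]
  define v where "v = R y"
  have v: "v \<in> L" using y by (simp add: v_def)
  have "0 \<le> Re (cinner (R v) v) * t\<^sup>2 + 2 * (norm v)\<^sup>2 * t" for t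
  proof -
    have "y + t *\<^sub>R v \<in> L" using y v by simp
    then have "cinner (R (y + t *\<^sub>R v)) (y + t *\<^sub>R v) \<in> \<real>\<^sub>\<ge>\<^sub>0"
      using R unfolding positive_op_def by blast
    then have "0 \<le> Re (cinner (R (y + t *\<^sub>R v)) (y + t *\<^sub>R v))"
      by (simp only: complex_nonneg_Reals_iff)
    also have "\<dots> = Re (cinner (R v) v) * t\<^sup>2 + 2 * (norm v)\<^sup>2 * t"
      using y v z positive_op_sym[OF L R v y]
      by (simp add: cinner_add_left cinner_add_right cinner_scaleR_left cinner_scaleR_right
          power2_eq_square algebra_simps)
         (simp add: v_def[symmetric] Re_cinner_self power2_eq_square)
    finally show ?thesis .
  qed
  then have "2 * (norm v)\<^sup>2 = 0" by (rule linear_term_zero_if_quadratic_nonneg)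
  then show ?thesis by (simp add: v_def)
qed

context symmetric_contraction
begin

text \<open>\<open>R\<close> commutes with \<open>I - C\<close>, its own square, hence with
  \<open>rt\<close>. So \<open>R + rt\<close> kills \<open>y = (R - rt) x\<close>; by positivity
  both \<open>R\<close> and \<open>rt\<close> kill it, and symmetry gives that \<open>y\<close> is
  orthogonal to itself.\<close>

lemma rt_unique:
  assumes R: "positive_op L R" and sq: "\<And>x. x \<in> L \<Longrightarrow> R (R x) = x - C x" and x: "x \<in> L"
  shows "R x = rt x"
proof -
  have Rb: "bounded_op L L R" using R by (simp add: positive_op_def)
  note Rl = bounded_op_clinear_on[OF Rb]
  have rtl: "clinear_on L L rt" using rt_positive by (simp add: positive_op_def bounded_op_iff)
  have RC: "R (C v) = C (R v)" if v: "v \<in> L" for v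
  proof -
    have "R (v - C v) = R v - C (R v)"
      using sq[of "R v"] sq[OF v] v clinear_onD[OF Rl] by simp
    then show ?thesis using v by (simp add: clinear_on_diff[OF subL Rl] clinear_onD[OF lin])
  qed
  have comm: "R (rt v) = rt (R v)" if "v \<in> L" for v
    by (rule sqrt_lim_intertwine[OF symmetric_contraction_axioms symmetric_contraction_axioms Rb RC that])
  define d where "d v = R v - rt v" for v
  have d_in: "d v \<in> L" if "v \<in> L" for v
    using that by (simp add: d_def rt_in clinear_onD(1)[OF Rl] csubspaceD[OF subL])
  define y where "y = d x"
  have y: "y \<in> L" using d_in[OF x] by (simp add: y_def)
  have "R y + rt y = 0"
    using x unfolding y_def d_def
    by (simp add: clinear_on_diff[OF subL Rl] clinear_on_diff[OF subL rtl] rt_in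
        clinear_onD(1)[OF Rl] comm sq rt_square)
  then have "cinner (R y) y + cinner (rt y) y = 0" by (simp flip: cinner_add_left)
  moreover have "cinner (R y) y \<in> \<real>\<^sub>\<ge>\<^sub>0" "cinner (rt y) y \<in> \<real>\<^sub>\<ge>\<^sub>0"
    using R rt_positive y by (auto simp: positive_op_def)
  ultimately have "cinner (R y) y = 0" "cinner (rt y) y = 0"
    by (auto simp: complex_nonneg_Reals_iff complex_eq_iff)
  then have "R y = 0" "rt y = 0"
    using positive_op_zero[OF subL] R rt_positive y by auto
  then have "cinner x (R y - rt y) = 0" by simp
  then have "cinner (d x) y = 0"
    using x y positive_op_sym[OF subL R x y] rt_sym[OF x y]
    by (simp add: d_def cinner_diff_left cinner_diff_right)
  then show ?thesis by (simp add: y_def[symmetric] cinner_self) (simp add: y_def d_def)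
qed

lemma sqrt_op_eq: "x \<in> L \<Longrightarrow> sqrt_op L (\<lambda>x. x - C x) x = rt x"
  and sqrt_op_positive: "positive_op L (sqrt_op L (\<lambda>x. x - C x))"
proof -
  let ?R = "sqrt_op L (\<lambda>x. x - C x)"
  have "positive_op L ?R \<and> (\<forall>x\<in>L. ?R (?R x) = x - C x)"
    unfolding sqrt_op_def by (rule someI[of _ rt]) (simp add: rt_positive rt_square)
  then show "positive_op L ?R" "x \<in> L \<Longrightarrow> ?R x = rt x"
    using rt_unique by auto
qed

end

section \<open>Defect operators of a contraction\<close>

context contraction
begin

lemma adj_comp: "symmetric_contraction L (\<lambda>x. Tadj (T x))"
proof -
  interpret adj: contraction K L Tadj by (rule adj_contraction)
  have "clinear_on L L (\<lambda>x. Tadj (T x))"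
    by (rule clinear_on_compose[OF lin adj.lin])
  moreover have le: "norm (Tadj (T x)) \<le> norm x" if "x \<in> L" for x
    using adj.contr[of "T x"] contr[of x] clinear_onD(1)[OF lin] that by force
  ultimately show ?thesis
    by unfold_locales
       (auto simp: L bounded_op_iff adj' clinear_onD(1)[OF lin] simp flip: adj
        intro!: exI[of _ 1])
qed

abbreviation "D \<equiv> defect_op L T"
abbreviation "Dadj \<equiv> defect_op K Tadj"

lemma D_bounded: "bounded_op L L D"
  and D_sym: "x \<in> L \<Longrightarrow> y \<in> L \<Longrightarrow> cinner (D x) y = cinner x (D y)"
  and D_square: "x \<in> L \<Longrightarrow> D (D x) = x - Tadj (T x)"
  and D_eq: "x \<in> L \<Longrightarrow> D x = sqrt_lim (\<lambda>x. Tadj (T x)) x"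
proof -
  interpret C: symmetric_contraction L "\<lambda>x. Tadj (T x)" by (rule adj_comp)
  show "bounded_op L L D"
    unfolding defect_op_def using C.sqrt_op_positive by (simp add: positive_op_def)
  show eq: "x \<in> L \<Longrightarrow> D x = sqrt_lim (\<lambda>x. Tadj (T x)) x" for x
    unfolding defect_op_def by (rule C.sqrt_op_eq)
  show "x \<in> L \<Longrightarrow> y \<in> L \<Longrightarrow> cinner (D x) y = cinner x (D y)"
    by (simp add: eq C.rt_sym)
  show "x \<in> L \<Longrightarrow> D (D x) = x - Tadj (T x)"
    by (simp add: eq C.rt_in C.rt_square)
qed

lemma D_lin: "clinear_on L L D" by (rule bounded_op_clinear_on[OF D_bounded])

lemma D_norm:
  assumes "x \<in> L" shows "(norm (D x))\<^sup>2 = (norm x)\<^sup>2 - (norm (T x))\<^sup>2"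
proof -
  have "cinner (D x) (D x) = cinner x x - cinner (T x) (T x)"
    using assms
    by (simp add: D_sym D_square cinner_diff_right clinear_onD(1)[OF D_lin] clinear_onD(1)[OF lin] adj)
  then show ?thesis by (simp flip: Re_cinner_self)
qed

text \<open>The adjoint intertwines \<open>T T*\<close> with \<open>T* T\<close>, hence also the
  square roots of \<open>I - T T*\<close> and \<open>I - T* T\<close>.\<close>

lemma adj_Dadj: assumes "y \<in> K" shows "Tadj (Dadj y) = D (Tadj y)"
proof -
  interpret adj: contraction K L Tadj by (rule adj_contraction)
  show ?thesis
    using assms
    by (simp add: D_eq adj.D_eq adj_in
        sqrt_lim_intertwine[OF adj.adj_comp adj_comp adj.op] adj_adj)
qed

lemma defect_space_chilbert: "chilbert (defect_space L T)"
  unfolding chilbert_def defect_space_def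
  by (simp add: csubspace_closure csubspace_image[OF subL D_lin])

lemma defect_space_subset: "defect_space L T \<subseteq> L"
  unfolding defect_space_def using clinear_onD(1)[OF D_lin] clL
  by (intro closure_minimal) auto

lemma D_in_defect_space: "x \<in> L \<Longrightarrow> D x \<in> defect_space L T"
  unfolding defect_space_def by (rule closure_subset[THEN subsetD], rule imageI)

text \<open>Clear on the range of \<open>Dadj\<close> by \<open>adj_Dadj\<close>, and extended to
  its closure by continuity. This puts the lower right entry of a rotation into the correct
  space.\<close>

lemma adj_defect_space:
  assumes "y \<in> defect_space K Tadj" shows "Tadj y \<in> defect_space L T"
proof -
  interpret adj: contraction K L Tadj by (rule adj_contraction)
  obtain f where f: "\<And>j. f j \<in> Dadj ` K" "f \<longlonglongrightarrow> y"
    using assms unfolding defect_space_def closure_sequential by blast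
  have yK: "y \<in> K" using assms adj.defect_space_subset by blast
  have "Tadj (f j) \<in> defect_space L T" for j
    using f(1)[of j] by (auto simp: adj_Dadj intro!: D_in_defect_space adj_in)
  moreover have "f j \<in> K" for j using f(1)[of j] by (auto intro: clinear_onD(1)[OF adj.D_lin])
  then have "(\<lambda>j. Tadj (f j)) \<longlonglongrightarrow> Tadj y"
    using f(2) yK by (intro bounded_op_tendsto[OF subK adj.op])
  ultimately show ?thesis
    using closed_sequentially[of "defect_space L T" "\<lambda>j. Tadj (f j)"] defect_space_chilbert
    by (simp add: chilbert_def)
qed

text \<open>The cross terms cancel because \<open>\<Gamma>\<^sup>* D\<^bsub>\<Gamma>\<^sup>*\<^esub> = D\<^bsub>\<Gamma>\<^esub> \<Gamma>\<^sup>*\<close>.\<close>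

lemma rotation_isometry:
  assumes x: "x \<in> L" and y: "y \<in> K"
  shows "(norm (T x + Dadj y))\<^sup>2 + (norm (D x - Tadj y))\<^sup>2 = (norm x)\<^sup>2 + (norm y)\<^sup>2"
proof -
  interpret adj: contraction K L Tadj by (rule adj_contraction)
  have "cinner (T x) (Dadj y) = cinner (D x) (Tadj y)"
    using x y by (simp add: adj clinear_onD(1)[OF adj.D_lin] adj_Dadj D_sym adj_in)
  then show ?thesis
    using D_norm[OF x] adj.D_norm[OF y] by (simp add: norm_add_sq norm_diff_sq)
qed

end

section \<open>Resolvents of contractions\<close>

text \<open>Solving \<open>x - f x = g\<close> is Banach's fixed-point problem for
  \<open>g + f x\<close>. It provides the inverse in a Schur step and both inverses in the final
  formulas.\<close>

lemma bij_betw_diff_contraction: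
  fixes L :: "'a::complex_hilbert set"
  assumes L: "chilbert L" and f: "clinear_on L L f"
    and le: "\<And>x. x \<in> L \<Longrightarrow> norm (f x) \<le> c * norm x" and c: "0 \<le> c" "c < 1"
  shows "bij_betw (\<lambda>x. x - f x) L L"
proof -
  have sub: "csubspace L" and cl: "closed L" using L by (auto simp: chilbert_def)
  have ex: "\<exists>!x. x \<in> L \<and> g + f x = x" if "g \<in> L" for g
  proof (rule Banach_fix[OF _ _ c])
    show "complete L" using cl by (simp add: complete_eq_closed)
    show "L \<noteq> {}" using that by blast
    show "(\<lambda>x. g + f x) ` L \<subseteq> L"
      using that by (auto intro!: csubspaceD[OF sub] clinear_onD(1)[OF f])
    show "dist (g + f x) (g + f y) \<le> c * dist x y" if "x \<in> L" "y \<in> L" for x y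
      using le[OF csubspaceD(5)[OF sub that]] clinear_on_diff[OF sub f that]
      by (simp add: dist_norm)
  qed
  show ?thesis
    unfolding bij_betw_def
  proof (intro conjI equalityI subsetI)
    show "inj_on (\<lambda>x. x - f x) L"
    proof (rule inj_onI)
      fix x y assume xy: "x \<in> L" "y \<in> L" "x - f x = y - f y"
      then have "(x - f x) \<in> L" by (simp add: csubspaceD[OF sub] clinear_onD(1)[OF f])
      moreover have "(x - f x) + f x = x" by simp
      moreover have "(x - f x) + f y = y" unfolding xy(3) by simp
      ultimately show "x = y" using ex xy(1,2) by blast
    qed
    show "y \<in> L" if "y \<in> (\<lambda>x. x - f x) ` L" for y
      using that by (auto intro!: csubspaceD[OF sub] clinear_onD(1)[OF f])
    show "g \<in> (\<lambda>x. x - f x) ` L" if g: "g \<in> L" for g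
    proof -
      obtain x where "x \<in> L" "g + f x = x" using ex[OF g] by blast
      then show ?thesis by (intro image_eqI[of _ _ x]) (simp_all add: algebra_simps)
    qed
  qed
qed

text \<open>\<open>N\<close> plays the role of a norm on \<open>K\<close> only, since the type
  carries none. Completeness is stated as convergence of absolutely convergent series, the form in
  which the Neumann series calls for it.\<close>

locale resolvent =
  fixes K :: "'v::complex_vector set" and N :: "'v \<Rightarrow> real" and S :: "'v \<Rightarrow> 'v"
  assumes sub: "csubspace K" and S: "clinear_on K K S"
    and N_add: "\<And>x y. x \<in> K \<Longrightarrow> y \<in> K \<Longrightarrow> N (x + y) \<le> N x + N y"
    and N_scale: "\<And>a x. x \<in> K \<Longrightarrow> N (a *C x) = cmod a * N x"
    and N_definite: "\<And>x. x \<in> K \<Longrightarrow> N x = 0 \<Longrightarrow> x = 0"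
    and S_le: "\<And>x. x \<in> K \<Longrightarrow> N (S x) \<le> N x"
    and complete: "\<And>s. (\<And>j. s j \<in> K) \<Longrightarrow> summable (\<lambda>j. N (s j)) \<Longrightarrow>
      \<exists>h\<in>K. (\<lambda>j::nat. N (h - (\<Sum>i<j. s i))) \<longlonglongrightarrow> 0"
begin

lemmas K_simps = csubspaceD[OF sub] clinear_onD(1)[OF S]

lemma N_zero: "N 0 = 0"
  using N_scale[of 0 0] by (simp add: K_simps)

lemma N_minus: "x \<in> K \<Longrightarrow> N (- x) = N x"
  using N_scale[of x "-1"] by (simp add: scaleC_minus_one)

lemma N_nonneg: "x \<in> K \<Longrightarrow> 0 \<le> N x"
  using N_add[of x "- x"] by (simp add: N_zero N_minus K_simps)

definition E :: "complex \<Rightarrow> 'v \<Rightarrow> 'v" where "E z h = h - z *C S h"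

definition R :: "complex \<Rightarrow> 'v \<Rightarrow> 'v" where "R z = the_inv_into K (E z)"

lemma E_lin: "clinear_on K K (E z)"
  unfolding E_def clinear_on_def
  by (auto simp: K_simps clinear_onD[OF S] scaleC_add_right scaleC_diff_right scaleC_commute)

lemma E_lower:
  assumes "h \<in> K" shows "(1 - cmod z) * N h \<le> N (E z h)"
proof -
  have "N h \<le> N (E z h) + N (z *C S h)"
    using N_add[of "E z h" "z *C S h"] assms by (simp add: E_def K_simps)
  also have "N (z *C S h) \<le> cmod z * N h"
    using assms by (simp add: N_scale K_simps S_le mult_left_mono)
  finally show ?thesis by (simp add: algebra_simps)
qed

text \<open>Injectivity comes from the lower bound \<open>E_lower\<close>, surjectivity from the
  Neumann series.\<close>

lemma E_bij:
  assumes z: "cmod z < 1" shows "bij_betw (E z) K K"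
  unfolding bij_betw_def
proof (intro conjI equalityI subsetI)
  show "inj_on (E z) K"
  proof (rule inj_onI)
    fix x y assume xy: "x \<in> K" "y \<in> K" "E z x = E z y"
    then have "E z (x - y) = 0" by (simp add: clinear_on_diff[OF sub E_lin])
    then have "(1 - cmod z) * N (x - y) \<le> 0"
      using E_lower[of "x - y" z] xy by (simp add: K_simps N_zero)
    then have "N (x - y) \<le> 0" using z by (simp add: mult_le_0_iff)
    then have "N (x - y) = 0" using N_nonneg[of "x - y"] xy by (simp add: K_simps)
    then show "x = y" using N_definite[of "x - y"] xy by (simp add: K_simps)
  qed
  show "y \<in> K" if "y \<in> E z ` K" for y using that clinear_onD(1)[OF E_lin] by auto
next
  fix g assume g: "g \<in> K"
  \<comment> \<open>The terms of the Neumann series applied to \<open>g\<close>.\<close>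
  define s where "s j = ((\<lambda>h. z *C S h) ^^ j) g" for j
  have s_in: "s j \<in> K" for j by (induction j) (simp_all add: s_def g K_simps)
  have s_Suc: "s (Suc j) = z *C S (s j)" for j by (simp add: s_def)
  have s_le: "N (s j) \<le> cmod z ^ j * N g" for j
  proof (induction j)
    case (Suc j)
    have "N (s (Suc j)) \<le> cmod z * N (s j)"
      using s_in[of j] by (simp add: s_Suc N_scale K_simps S_le mult_left_mono)
    also have "\<dots> \<le> cmod z * (cmod z ^ j * N g)" by (intro mult_left_mono Suc) simp
    finally show ?case by simp
  qed (simp add: s_def)
  have "summable (\<lambda>j. cmod z ^ j * N g)" using z by (intro summable_mult2 summable_geometric) simp
  then have "summable (\<lambda>j. N (s j))"
    by (rule summable_comparison_test[rotated]) (auto intro!: exI[of _ 0] s_le simp: N_nonneg s_in)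
  then obtain h where h: "h \<in> K" and lim: "(\<lambda>j. N (h - (\<Sum>i<j. s i))) \<longlonglongrightarrow> 0"
    using complete[of s] s_in by blast
  define p where "p j = (\<Sum>i<j. s i)" for j
  have p_in: "p j \<in> K" for j unfolding p_def by (induction j) (simp_all add: K_simps s_in)
  have p_Suc: "p (Suc j) = g + z *C S (p j)" for j
  proof (induction j)
    case 0
    show ?case by (simp add: p_def s_def clinear_on_zero[OF sub S])
  next
    case (Suc j)
    have "p (Suc (Suc j)) = (g + z *C S (p j)) + z *C S (s j)"
      using Suc by (simp add: p_def s_Suc)
    moreover have "p (Suc j) = p j + s j" by (simp add: p_def)
    ultimately show ?case
      by (simp add: clinear_onD(2)[OF S p_in s_in] scaleC_add_right)
  qed
  \<comment> \<open>By the recursion for \<open>p\<close>, \<open>E z h - g\<close> is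
    \<open>h - p (Suc j)\<close> minus \<open>z\<close> times \<open>S (h - p j)\<close>; both
    distances tend to 0.\<close>
  have "N (E z h - g) \<le> N (h - p (Suc j)) + N (h - p j)" for j
  proof -
    have "E z h - g = (h - p (Suc j)) + (- (z *C S (h - p j)))"
      by (simp add: E_def p_Suc clinear_on_diff[OF sub S h p_in] scaleC_diff_right)
    then have "N (E z h - g) \<le> N (h - p (Suc j)) + N (- (z *C S (h - p j)))"
      using N_add[of "h - p (Suc j)" "- (z *C S (h - p j))"] h p_in by (simp add: K_simps)
    also have "N (- (z *C S (h - p j))) = cmod z * N (S (h - p j))"
      using h p_in by (simp add: N_minus N_scale K_simps)
    also have "\<dots> \<le> 1 * N (h - p j)"
      using h p_in z by (intro mult_mono S_le) (simp_all add: K_simps N_nonneg)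
    finally show ?thesis by simp
  qed
  moreover have "(\<lambda>j. N (h - p (Suc j)) + N (h - p j)) \<longlonglongrightarrow> 0 + 0"
    using lim unfolding p_def[symmetric] by (intro tendsto_add LIMSEQ_Suc)
  ultimately have "N (E z h - g) \<le> 0 + 0"
    by (intro LIMSEQ_le_const[of _ "0 + 0"]) auto
  then have "E z h - g = 0"
    using N_definite[of "E z h - g"] N_nonneg[of "E z h - g"] h g clinear_onD(1)[OF E_lin]
    by (simp add: K_simps)
  then show "g \<in> E z ` K" using h by (metis eq_iff_diff_eq_0 imageI)
qed

context
  fixes z :: complex
  assumes z: "cmod z < 1"
begin

lemma R_in: "g \<in> K \<Longrightarrow> R z g \<in> K"
  and E_R: "g \<in> K \<Longrightarrow> E z (R z g) = g"
  and R_E: "h \<in> K \<Longrightarrow> R z (E z h) = h"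
  unfolding R_def using E_bij[OF z]
  by (auto simp: bij_betw_def the_inv_into_into f_the_inv_into_f the_inv_into_f_f)

lemma R_eqI: "h \<in> K \<Longrightarrow> E z h = g \<Longrightarrow> R z g = h"
  using R_E by blast

lemma R_lin: "clinear_on K K (R z)"
  unfolding clinear_on_def
  by (auto intro!: R_eqI simp: R_in K_simps clinear_onD[OF E_lin] E_R)

text \<open>\<open>z\<close> stands inside \<open>S\<close> because the energy balance is later
  applied to the state \<open>z *C R z g\<close>.\<close>

lemma R_fixpoint: "g \<in> K \<Longrightarrow> R z g = S (z *C R z g) + g"
  using E_R[of g] R_in[of g] by (simp add: E_def clinear_onD(3)[OF S] algebra_simps)

lemma R_norm: "g \<in> K \<Longrightarrow> N (R z g) \<le> N g / (1 - cmod z)"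
  using E_lower[of "R z g" z] z by (simp add: R_in E_R pos_le_divide_eq mult.commute)

end

lemma R_diff:
  assumes z: "cmod z < 1" and w: "cmod w < 1" and g: "g \<in> K"
  shows "R w g - R z g = (w - z) *C R w (S (R z g))"
proof -
  have "E w (R w g - R z g) = E z (R z g) - E w (R z g)"
    by (simp add: clinear_on_diff[OF sub E_lin] E_R R_in assms)
  also have "\<dots> = (w - z) *C S (R z g)"
    by (simp add: E_def scaleC_diff_left)
  finally have "R w ((w - z) *C S (R z g)) = R w g - R z g"
    by (intro R_eqI[OF w]) (simp_all add: R_in K_simps assms)
  then show ?thesis by (simp add: clinear_onD(3)[OF R_lin] R_in assms K_simps)
qed

text \<open>The resolvent identity for \<open>z R(z)\<close>, the combination found in a transfer
  function. It is free of \<open>S\<close> and shows that the derivative is the square of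
  \<open>R z\<close>.\<close>

lemma scaled_R_diff:
  assumes z: "cmod z < 1" and w: "cmod w < 1" and g: "g \<in> K"
  shows "w *C R w g - z *C R z g = (w - z) *C R w (R z g)"
proof -
  have "w *C R w g = w *C R z g + (w *C (w - z) *C R w (S (R z g)))"
    using arg_cong[OF R_diff[OF assms], of "\<lambda>v. w *C v"] by (simp add: scaleC_diff_right algebra_simps)
  moreover have "R w (R z g) = R z g + w *C R w (S (R z g))"
  proof -
    have "R w (E w (R z g)) = R z g" by (simp add: R_E R_in assms)
    moreover have "R w (E w (R z g)) = R w (R z g) - w *C R w (S (R z g))"
      by (simp add: E_def clinear_on_diff[OF sub R_lin] clinear_onD(3)[OF R_lin] R_in assms K_simps)
    ultimately show ?thesis by (simp add: algebra_simps)
  qed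
  ultimately show ?thesis
    by (simp add: scaleC_add_right scaleC_diff_left scaleC_commute)
qed

lemma R_diff_norm:
  assumes z: "cmod z < 1" and w: "cmod w < 1" and g: "g \<in> K"
  shows "N (R w g - R z g) \<le> cmod (w - z) * (N g / ((1 - cmod z) * (1 - cmod w)))"
proof -
  have "N (R w (S (R z g))) \<le> N (S (R z g)) / (1 - cmod w)"
    by (intro R_norm K_simps R_in assms)
  also have "\<dots> \<le> N (R z g) / (1 - cmod w)"
    using w by (intro divide_right_mono S_le R_in assms) simp
  also have "\<dots> \<le> N g / (1 - cmod z) / (1 - cmod w)"
    using w by (intro divide_right_mono R_norm assms) simp
  finally have "N (R w (S (R z g))) \<le> N g / ((1 - cmod z) * (1 - cmod w))" by simp
  then have "cmod (w - z) * N (R w (S (R z g))) \<le> cmod (w - z) * (N g / ((1 - cmod z) * (1 - cmod w)))"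
    by (rule mult_left_mono) simp
  then show ?thesis
    by (simp only: R_diff[OF assms] N_scale[OF R_in[OF w clinear_onD(1)[OF S R_in[OF z g]]]])
qed

text \<open>The derivative is \<open>Out\<close> after the squared resolvent after \<open>J\<close>;
  the constant part \<open>c\<close> drops out of every difference.\<close>

lemma transfer_function_holomorphic:
  fixes J :: "'a::complex_inner \<Rightarrow> 'v" and Out :: "'v \<Rightarrow> 'b::complex_inner"
  assumes J: "clinear_on M K J" and J_le: "\<And>p. p \<in> M \<Longrightarrow> N (J p) \<le> norm p"
    and Out: "clinear_on K M' Out" and Out_le: "\<And>h. h \<in> K \<Longrightarrow> norm (Out h) \<le> N h"
    and F: "\<And>z p. cmod z < 1 \<Longrightarrow> p \<in> M \<Longrightarrow> F z p = c p + z *C Out (R z (J p))"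
  shows "op_holomorphic M M' F"
  unfolding op_holomorphic_def
proof (intro ballI)
  fix z :: complex assume "z \<in> ball 0 1"
  then have z: "cmod z < 1" by simp
  define d where "d = 1 - cmod z"
  have d: "d > 0" using z by (simp add: d_def)
  define F' where "F' p = Out (R z (R z (J p)))" for p
  have J_in: "J p \<in> K" if "p \<in> M" for p using that by (rule clinear_onD(1)[OF J])
  have F'_lin: "clinear_on M M' F'"
    unfolding F'_def by (intro clinear_on_compose[OF _ Out] clinear_on_compose[OF _ R_lin[OF z]] J)
  have RJ: "N (R z (J p)) \<le> norm p / d" if "p \<in> M" for p
    using R_norm[OF z J_in[OF that]] divide_right_mono[OF J_le[OF that], of d] d
    unfolding d_def by linarith
  have "norm (F' p) \<le> (1 / (d * d)) * norm p" if "p \<in> M" for p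
  proof -
    have "norm (F' p) \<le> N (R z (R z (J p)))"
      unfolding F'_def by (intro Out_le R_in z J_in that)
    also have "\<dots> \<le> N (R z (J p)) / d" unfolding d_def by (intro R_norm R_in z J_in that)
    also have "\<dots> \<le> norm p / d / d" using d by (intro divide_right_mono RJ that) simp
    finally show ?thesis by simp
  qed
  with F'_lin have F'_op: "bounded_op M M' F'" unfolding bounded_op_iff by blast
  have quotient: "norm (inverse (w - z) *C (F w p - F z p) - F' p) \<le> cmod (w - z) * (2 / d ^ 3) * norm p"
    if p: "p \<in> M" and w: "w \<noteq> z" "cmod (w - z) < d / 2" for w p
  proof -
    \<comment> \<open>Within distance \<open>d / 2\<close> of \<open>z\<close> the gap to the unit
      circle is still at least \<open>d / 2\<close>. With two factors \<open>d\<close> from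
      resolvents at \<open>z\<close>, this produces \<open>2 / d ^ 3\<close>.\<close>
    have dw: "d / 2 \<le> 1 - cmod w"
      using w(2) norm_triangle_ineq[of z "w - z"] by (simp add: d_def field_simps)
    then have w1: "cmod w < 1" using d by linarith
    define u where "u = R z (J p)"
    have u: "u \<in> K" unfolding u_def by (intro R_in z J_in p)
    have "F w p - F z p = Out (w *C R w (J p) - z *C R z (J p))"
      by (simp add: F p z w1 clinear_on_diff[OF sub Out] clinear_onD(3)[OF Out] R_in J_in K_simps)
    also have "\<dots> = (w - z) *C Out (R w u)"
      by (simp add: scaled_R_diff z w1 J_in p clinear_onD(3)[OF Out] R_in u_def)
    finally have "inverse (w - z) *C (F w p - F z p) - F' p = Out (R w u - R z u)"
      using w(1) by (simp add: scaleC_scaleC F'_def u_def[symmetric] clinear_on_diff[OF sub Out] R_in z w1 u)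
    then have "norm (inverse (w - z) *C (F w p - F z p) - F' p) \<le> N (R w u - R z u)"
      by (simp add: Out_le K_simps R_in z w1 u)
    also have "\<dots> \<le> cmod (w - z) * (N u / (d * (1 - cmod w)))"
      using R_diff_norm[OF z w1 u] by (simp add: d_def)
    also have "\<dots> \<le> cmod (w - z) * ((norm p / d) / (d * (d / 2)))"
      using d dw RJ[OF p] unfolding u_def[symmetric]
      by (intro mult_left_mono frac_le) (simp_all add: N_nonneg u)
    also have "\<dots> = cmod (w - z) * (2 / d ^ 3) * norm p"
      by (simp add: power3_eq_cube mult_ac)
    finally show ?thesis .
  qed
  show "\<exists>F'. bounded_op M M' F' \<and> (\<forall>e>0. \<forall>\<^sub>F w in at z. \<forall>x\<in>M.
           norm (inverse (w - z) *C (F w x - F z x) - F' x) \<le> e * norm x)"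
  proof (intro exI[of _ F'] conjI allI impI F'_op)
    fix e :: real assume e: "e > 0"
    have "\<forall>\<^sub>F w in at z. dist w z < min (d / 2) (e * d ^ 3 / 2)"
      using d e by (intro eventually_at_topological[THEN iffD2] exI[of _ "ball z (min (d / 2) (e * d ^ 3 / 2))"])
        (auto simp: dist_commute)
    moreover have "\<forall>\<^sub>F w in at z. w \<noteq> z" by (simp add: eventually_at_filter)
    ultimately show "\<forall>\<^sub>F w in at z. \<forall>x\<in>M.
        norm (inverse (w - z) *C (F w x - F z x) - F' x) \<le> e * norm x"
    proof eventually_elim
      case (elim w)
      have "cmod (w - z) * (2 / d ^ 3) \<le> e"
        using elim d by (simp add: dist_norm field_simps)
      moreover have "w \<noteq> z" "cmod (w - z) < d / 2" using elim by (simp_all add: dist_norm)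
      ultimately show ?case
        by (meson quotient mult_right_mono norm_ge_zero order_trans)
    qed
  qed
qed

end

section \<open>The state space\<close>

text \<open>The pointwise operations make the direct sum \<open>K_sp\<close> a subspace of a vector
  space of sequences, as the locale \<open>resolvent\<close> expects.\<close>

instantiation "fun" :: (type, real_vector) real_vector
begin
definition scaleR_fun_def: "r *\<^sub>R f = (\<lambda>x. r *\<^sub>R f x)"
instance
  by standard (simp_all add: scaleR_fun_def fun_eq_iff scaleR_add_right scaleR_add_left)
end

instantiation "fun" :: (type, complex_vector) complex_vector
begin
definition scaleC_fun_def: "a *C f = (\<lambda>x. a *C f x)"
instance
  by standard
    (simp_all add: scaleC_fun_def scaleR_fun_def fun_eq_iff scaleC_add_right scaleC_add_left
      scaleC_scaleC scaleR_scaleC)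
end

lemma scaleC_fun_apply [simp]: "(a *C f) x = a *C f x"
  by (simp add: scaleC_fun_def)

lemma sum_fun_apply: "(\<Sum>i\<in>A. f i) x = (\<Sum>i\<in>A. f i x)"
  by (induction A rule: infinite_finite_induct) auto

lemma norm_prod_sq: "(norm p)\<^sup>2 = (norm (fst p))\<^sup>2 + (norm (snd p))\<^sup>2"
  by (simp add: norm_prod_def)

lemma fst_scaleC: "fst (a *C p) = a *C fst p"
  and snd_scaleC: "snd (a *C p) = a *C snd p"
  and scaleC_Pair: "a *C (x, y) = (a *C x, a *C y)"
  by (simp_all add: scaleC_prod_def)

lemma csubspace_Times: "csubspace L \<Longrightarrow> csubspace K \<Longrightarrow> csubspace (L \<times> K)"
  by (auto simp: csubspace_def scaleC_prod_def zero_prod_def)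

lemma chilbert_Times: "chilbert L \<Longrightarrow> chilbert K \<Longrightarrow> chilbert (L \<times> K)"
  by (simp add: chilbert_def csubspace_Times closed_Times)

lemma chilbert_UNIV: "chilbert UNIV"
  by (simp add: chilbert_def csubspace_def)

lemma clinear_on_fst: "clinear_on L (K \<times> M) F \<Longrightarrow> clinear_on L K (\<lambda>x. fst (F x))"
  and clinear_on_snd: "clinear_on L (K \<times> M) F \<Longrightarrow> clinear_on L M (\<lambda>x. snd (F x))"
  by (auto simp: clinear_on_def scaleC_prod_def mem_Times_iff)

lemma clinear_on_Pair:
  "clinear_on L K F \<Longrightarrow> clinear_on L M H \<Longrightarrow> clinear_on L (K \<times> M) (\<lambda>x. (F x, H x))"
  by (auto simp: clinear_on_def scaleC_prod_def)

text \<open>\<open>V_op\<close> acts within the components, \<open>W_op\<close> across neighbouring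
  ones. This passes from the first grouping of the entries to the second.\<close>

lemma sum_norm_sq_regroup:
  fixes h :: "nat \<Rightarrow> 'a::real_normed_vector \<times> 'b::real_normed_vector"
  shows "(\<Sum>k\<in>{1..n + 1}. (norm (h k))\<^sup>2) = (norm (fst (h 1)))\<^sup>2 +
    (\<Sum>k\<in>{1..n}. (norm (snd (h k)))\<^sup>2 + (norm (fst (h (Suc k))))\<^sup>2) + (norm (snd (h (n + 1))))\<^sup>2"
  by (induction n) (simp_all add: norm_prod_sq)

section \<open>Schur parameters\<close>

text \<open>Everything about the system depends only on the parameters being contractions between
  successive defect spaces; the function they come from enters later.\<close>

locale schur_parameters =
  fixes G :: "nat \<Rightarrow> 'm::complex_hilbert \<Rightarrow> 'n::complex_hilbert" and n :: nat
  assumes G_contraction: "contraction (par_dom G k) (par_cod G k) (G k)"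
begin

text \<open>Unfolding would turn each \<open>P (Suc k)\<close> into nested defect spaces; the
  recursion is invoked only where a defect space is meant.\<close>

declare par_dom.simps(2) [simp del] par_cod.simps(2) [simp del]

abbreviation "P \<equiv> par_dom G"
abbreviation "Q \<equiv> par_cod G"

lemma adj_contraction: "contraction (Q k) (P k) (par_adj G k)"
  unfolding par_adj_def by (rule contraction.adj_contraction[OF G_contraction])

lemma P_chilbert: "chilbert (P k)" and Q_chilbert: "chilbert (Q k)"
  using contraction.L[OF G_contraction] contraction.K[OF G_contraction] by auto

lemma P_sub: "csubspace (P k)" and Q_sub: "csubspace (Q k)"
  using P_chilbert Q_chilbert by (auto simp: chilbert_def)

lemma Q_Suc_subset: "Q (Suc k) \<subseteq> Q k"
  using contraction.defect_space_subset[OF adj_contraction] by (simp add: par_cod.simps(2))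

lemma dop_lin: "clinear_on (P k) (P (Suc k)) (dop G k)"
  and dop_star_lin: "clinear_on (Q k) (Q (Suc k)) (dop_star G k)"
  using contraction.D_lin[OF G_contraction] contraction.D_in_defect_space[OF G_contraction]
    contraction.D_lin[OF adj_contraction] contraction.D_in_defect_space[OF adj_contraction]
  by (simp_all add: clinear_on_def dop_def dop_star_def par_dom.simps(2) par_cod.simps(2))

lemma G_lin: "clinear_on (P k) (Q k) (G k)"
  by (rule contraction.lin[OF G_contraction])

lemma par_adj_lin: "clinear_on (Q (Suc k)) (P (Suc k)) (par_adj G k)"
proof -
  have "y \<in> Q k" if "y \<in> Q (Suc k)" for y using that Q_Suc_subset by blast
  moreover have "par_adj G k y \<in> P (Suc k)" if "y \<in> Q (Suc k)" for y
    using contraction.adj_defect_space[OF G_contraction] that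
    by (simp add: par_adj_def par_dom.simps(2) par_cod.simps(2))
  ultimately show ?thesis
    using contraction.lin[OF adj_contraction, of k] by (simp add: clinear_on_def)
qed

text \<open>Index 0 is included, with the whole spaces as \<open>P 0\<close> and \<open>Q 0\<close>.
  The four entries of that rotation are spread over \<open>direct\<close>, \<open>outp\<close>,
  \<open>inp\<close> and the first entry of \<open>W_op\<close>.\<close>

lemma rotation_lin: "clinear_on (P k \<times> Q (Suc k)) (Q k \<times> P (Suc k)) (rotation G k)"
proof -
  have sub: "y \<in> Q k" if "y \<in> Q (Suc k)" for y using that Q_Suc_subset by blast
  show ?thesis
    unfolding clinear_on_def rotation_def
    by (auto simp: clinear_onD[OF G_lin] clinear_onD[OF dop_lin] clinear_onD[OF dop_star_lin]
      clinear_onD[OF par_adj_lin] sub scaleC_prod_def scaleC_add_right scaleC_diff_right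
      intro!: csubspaceD[OF P_sub] csubspaceD[OF Q_sub] clinear_onD(1)[OF dop_star_lin, THEN subsetD[OF Q_Suc_subset]])
qed

lemma rotation_norm:
  assumes "x \<in> P k" "y \<in> Q (Suc k)"
  shows "(norm (fst (rotation G k (x, y))))\<^sup>2 + (norm (snd (rotation G k (x, y))))\<^sup>2 = (norm x)\<^sup>2 + (norm y)\<^sup>2"
  using contraction.rotation_isometry[OF G_contraction assms(1), of y] assms(2) Q_Suc_subset
  by (auto simp: rotation_def dop_def dop_star_def par_adj_def)

section \<open>The state space and the factors V and W\<close>

lemma H_sp_eq:
  assumes "1 \<le> k" shows "H_sp G k = P (2 * k - 1) \<times> Q (2 * k)"
proof -
  have "Suc (2 * k - 2) = 2 * k - 1" "Suc (2 * k - 1) = 2 * k" using assms by auto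
  then show ?thesis
    using par_dom.simps(2)[of G "2 * k - 2"] par_cod.simps(2)[of G "2 * k - 1"]
    by (simp add: H_sp_def dsp_def dsp_star_def)
qed

lemma H_sp_chilbert: "1 \<le> k \<Longrightarrow> chilbert (H_sp G k)"
  by (simp add: H_sp_eq chilbert_Times P_chilbert Q_chilbert)

definition Kt :: "(nat \<Rightarrow> 'n \<times> 'm) set" where
  "Kt = {f. (\<forall>k\<in>{1..n + 1}. f k \<in> Q (2 * k - 1) \<times> P (2 * k)) \<and> (\<forall>k. k \<notin> {1..n + 1} \<longrightarrow> f k = 0)}"

text \<open>The pair straddling the components \<open>k\<close> and \<open>k + 1\<close>, on which
  \<open>W_op\<close> applies the rotation with index \<open>2 * k\<close>.\<close>

definition mid :: "(nat \<Rightarrow> 'n \<times> 'm) \<Rightarrow> nat \<Rightarrow> 'm \<times> 'n" where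
  "mid f k = (snd (f k), fst (f (Suc k)))"

lemma mid_add: "mid (f + g) k = mid f k + mid g k"
  and mid_scaleC: "mid (a *C f) k = a *C mid f k"
  by (simp_all add: mid_def scaleC_prod_def)

lemma Kt_fst: "f \<in> Kt \<Longrightarrow> k \<in> {1..n + 1} \<Longrightarrow> fst (f k) \<in> Q (2 * k - 1)"
  and Kt_snd: "f \<in> Kt \<Longrightarrow> k \<in> {1..n + 1} \<Longrightarrow> snd (f k) \<in> P (2 * k)"
  by (auto simp: Kt_def mem_Times_iff)

lemma mid_in: "f \<in> Kt \<Longrightarrow> k \<in> {1..n} \<Longrightarrow> mid f k \<in> P (2 * k) \<times> Q (Suc (2 * k))"
  using Kt_fst[of f "Suc k"] Kt_snd[of f k] by (simp add: mid_def)

lemma K_sub: "csubspace (K_sp G n)"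
proof -
  have "csubspace (H_sp G k)" if "k \<in> {1..n + 1}" for k
    using H_sp_chilbert[of k] that by (simp add: chilbert_def)
  note H = csubspaceD(1-3)[OF this]
  show ?thesis
    unfolding csubspace_def by (auto simp: K_sp_def H)
qed

lemma rotation_odd_lin:
  "1 \<le> k \<Longrightarrow> clinear_on (H_sp G k) (Q (2 * k - 1) \<times> P (2 * k)) (rotation G (2 * k - 1))"
  using rotation_lin[of "2 * k - 1"] by (simp add: H_sp_eq)

lemma V_lin: "clinear_on (K_sp G n) Kt (V_op G n)"
  using rotation_odd_lin
  by (auto simp: clinear_on_def V_op_def K_sp_def Kt_def fun_eq_iff)

lemma W_eq: "W_op G n f k = (if k \<in> {1..n + 1} then
    (if k = 1 then - par_adj G 0 (fst (f 1)) else snd (rotation G (2 * (k - 1)) (mid f (k - 1))),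
     if k = n + 1 then 0 else fst (rotation G (2 * k) (mid f k))) else 0)"
  by (auto simp: W_op_def mid_def)

lemma W_lin: "clinear_on Kt (K_sp G n) (W_op G n)"
proof -
  have 1: "fst (f 1) \<in> Q (Suc 0)" if "f \<in> Kt" for f using Kt_fst[OF that, of 1] by simp
  note rl = clinear_onD[OF rotation_lin]
  have m: "mid f (k - 1) \<in> P (2 * (k - 1)) \<times> Q (Suc (2 * (k - 1)))"
    if "f \<in> Kt" "k \<in> {1..n + 1}" "k \<noteq> 1" for f k by (rule mid_in[OF that(1)]) (use that in auto)
  have m': "mid f k \<in> P (2 * k) \<times> Q (Suc (2 * k))"
    if "f \<in> Kt" "k \<in> {1..n + 1}" "k \<noteq> n + 1" for f k by (rule mid_in[OF that(1)]) (use that in auto)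
  show ?thesis
    unfolding clinear_on_def
  proof (intro conjI ballI allI)
    fix f assume f: "f \<in> Kt"
    have "W_op G n f k \<in> H_sp G k" if k: "k \<in> {1..n + 1}" for k
    proof -
      have "(if k = 1 then - par_adj G 0 (fst (f 1)) else snd (rotation G (2 * (k - 1)) (mid f (k - 1))))
          \<in> P (2 * k - 1)"
      proof (cases "k = 1")
        case True
        then show ?thesis
          using clinear_onD(1)[OF par_adj_lin 1[OF f]] csubspaceD(4)[OF P_sub] by simp
      next
        case False
        moreover have "Suc (2 * (k - 1)) = 2 * k - 1" using k by auto
        ultimately show ?thesis
          using rl(1)[OF m[OF f k False]] by (simp add: mem_Times_iff)
      qed
      moreover have "(if k = n + 1 then 0 else fst (rotation G (2 * k) (mid f k))) \<in> Q (2 * k)"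
        using rl(1)[OF m'[OF f k]] csubspaceD(1)[OF Q_sub] by (auto simp: mem_Times_iff)
      ultimately show ?thesis using k unfolding W_eq by (simp add: H_sp_eq)
    qed
    then show "W_op G n f \<in> K_sp G n" by (auto simp: K_sp_def W_op_def)
  next
    fix f g assume f: "f \<in> Kt" and g: "g \<in> Kt"
    show "W_op G n (f + g) = W_op G n f + W_op G n g"
    proof
      fix k
      show "W_op G n (f + g) k = (W_op G n f + W_op G n g) k"
        using rl(2)[OF m[OF f] m[OF g], of k] rl(2)[OF m'[OF f] m'[OF g], of k]
        by (auto simp: W_eq mid_add clinear_onD(2)[OF par_adj_lin 1[OF f] 1[OF g], simplified])
    qed
  next
    fix a f assume f: "f \<in> Kt"
    show "W_op G n (a *C f) = a *C W_op G n f"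
    proof
      fix k
      show "W_op G n (a *C f) k = (a *C W_op G n f) k"
        using rl(3)[OF m[OF f], of k a] rl(3)[OF m'[OF f], of k a]
        by (auto simp: W_eq mid_scaleC clinear_onD(3)[OF par_adj_lin 1[OF f], simplified]
            scaleC_Pair fst_scaleC snd_scaleC scaleC_minus_right)
    qed
  qed
qed

lemma S_lin: "clinear_on (K_sp G n) (K_sp G n) (S_op G n)"
  unfolding S_op_def by (rule clinear_on_compose[OF V_lin W_lin])

section \<open>The system matrix and its energy balance\<close>

definition N :: "(nat \<Rightarrow> 'm \<times> 'n) \<Rightarrow> real" where
  "N h = L2_set (\<lambda>k. norm (h k)) {1..n + 1}"

lemma N_sq: "(N h)\<^sup>2 = (\<Sum>k\<in>{1..n + 1}. (norm (h k))\<^sup>2)"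
  by (simp add: N_def L2_set_def sum_nonneg)

lemma N_ge_0: "0 \<le> N h"
  by (simp add: N_def)

abbreviation "M \<equiv> (UNIV :: 'm set) \<times> Q (2 * n + 2)"

text \<open>\<open>S\<close>, \<open>inp\<close>, \<open>outp\<close> and \<open>direct\<close> are the four blocks of an isometric system matrix whose
  transfer function is \<open>Q_fun\<close>.\<close>

definition inp :: "'m \<times> 'n \<Rightarrow> nat \<Rightarrow> 'm \<times> 'n" where
  "inp p = incl_first (dop G 0 (fst p)) + incl_last n (snd p)"

definition outp :: "(nat \<Rightarrow> 'm \<times> 'n) \<Rightarrow> 'n \<times> 'm" where
  "outp h = (dop_star G 0 (row_first G (h 1)), row_last G n (h (n + 1)))"

definition direct :: "'m \<times> 'n \<Rightarrow> 'n \<times> 'm" where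
  "direct p = (G 0 (fst p), 0)"

lemma row_first_eq: "row_first G p = fst (rotation G 1 p)"
  and row_last_eq: "row_last G n p = snd (rotation G (2 * n + 1) p)"
  by (simp_all add: row_first_def row_last_def rotation_def split: prod.split)

lemma incl_first_lin: "clinear_on (P 1) (K_sp G n) incl_first"
  by (auto simp: clinear_on_def K_sp_def incl_first_def fun_eq_iff scaleC_prod_def H_sp_eq zero_prod_def
      csubspaceD[OF P_sub] csubspaceD[OF Q_sub])

lemma incl_last_lin: "clinear_on (Q (2 * n + 2)) (K_sp G n) (incl_last n)"
  by (auto simp: clinear_on_def K_sp_def incl_last_def fun_eq_iff scaleC_prod_def H_sp_eq zero_prod_def
      csubspaceD[OF P_sub] csubspaceD[OF Q_sub])

lemma inp_in:
  assumes "p \<in> M"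
  shows "incl_first (dop G 0 (fst p)) \<in> K_sp G n" "incl_last n (snd p) \<in> K_sp G n"
  using clinear_onD(1)[OF incl_first_lin] clinear_onD(1)[OF incl_last_lin]
    clinear_onD(1)[OF dop_lin[of 0]] assms
  by auto

lemma inp_lin: "clinear_on M (K_sp G n) inp"
  unfolding clinear_on_def inp_def
  using clinear_onD[OF incl_first_lin] clinear_onD[OF incl_last_lin] clinear_onD[OF dop_lin[of 0]]
  by (auto simp: scaleC_prod_def scaleC_add_right csubspaceD[OF K_sub])

lemma outp_lin: "clinear_on (K_sp G n) (UNIV \<times> P (2 * n + 2)) outp"
proof -
  have app: "clinear_on (K_sp G n) (H_sp G k) (\<lambda>h. h k)" if "k \<in> {1..n + 1}" for k
    using that by (auto simp: clinear_on_def K_sp_def)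
  have "clinear_on (K_sp G n) (Q 1) (\<lambda>h. fst (rotation G 1 (h 1)))"
    using clinear_on_compose[OF app rotation_odd_lin, of 1] by (intro clinear_on_fst) auto
  then have "clinear_on (K_sp G n) UNIV (\<lambda>h. dop_star G 0 (fst (rotation G 1 (h 1))))"
    using dop_star_lin[of 0] by (auto simp: clinear_on_def)
  moreover have "clinear_on (K_sp G n) (P (2 * n + 2)) (\<lambda>h. snd (rotation G (2 * n + 1) (h (n + 1))))"
    using clinear_on_compose[OF app rotation_odd_lin, of "n + 1"]
    by (intro clinear_on_snd) auto
  ultimately show ?thesis
    unfolding outp_def row_first_eq row_last_eq by (rule clinear_on_Pair)
qed

text \<open>\<open>V_op\<close> is isometric block by block. The input and output channels complete
  \<open>W_op\<close>: its corner \<open>- (G 0)*\<close> becomes the full rotation with index 0,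
  and at its corner 0 one vector leaves while \<open>y\<close> enters.\<close>

lemma system_isometry:
  assumes h: "h \<in> K_sp G n" and p: "p \<in> M"
  shows "(N (S_op G n h + inp p))\<^sup>2 + (norm (direct p + outp h))\<^sup>2 = (N h)\<^sup>2 + (norm p)\<^sup>2"
proof -
  obtain x y where xy: "p = (x, y)" by (cases p)
  define f where "f = V_op G n h"
  have f: "f \<in> Kt" unfolding f_def by (rule clinear_onD(1)[OF V_lin h])
  define r where "r = S_op G n h + inp p"
  have r: "r k = W_op G n f k + inp p k" for k by (simp add: r_def S_op_def f_def)
  have fk: "(norm (f k))\<^sup>2 = (norm (h k))\<^sup>2" if k: "k \<in> {1..n + 1}" for k
  proof -
    have "h k \<in> H_sp G k" using h k by (auto simp: K_sp_def)
    moreover have "Suc (2 * k - 1) = 2 * k" using k by auto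
    ultimately have "h k \<in> P (2 * k - 1) \<times> Q (Suc (2 * k - 1))"
      using k by (simp add: H_sp_eq)
    then show ?thesis
      using rotation_norm[of "fst (h k)" "2 * k - 1" "snd (h k)"] k
      by (simp add: f_def V_op_def norm_prod_sq mem_Times_iff)
  qed
  have f1: "fst (f 1) \<in> Q (Suc 0)" using Kt_fst[OF f, of 1] by simp
  \<comment> \<open>\<open>- (G 0)*\<close> from \<open>W_op\<close> and the defect operator from
    \<open>inp\<close> together form the second row of the rotation with index 0; its first row is
    the output in \<open>out\<close>.\<close>
  have r_first: "fst (r 1) = snd (rotation G 0 (x, fst (f 1)))"
    by (simp add: r W_eq inp_def incl_first_def incl_last_def xy rotation_def zero_prod_def)
  \<comment> \<open>\<open>W_op\<close> contributes 0 in this slot, so the input occupies it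
    alone.\<close>
  have r_last: "snd (r (n + 1)) = y"
    by (simp add: r W_eq inp_def incl_first_def incl_last_def xy zero_prod_def)
  have r_mid: "snd (r k) = fst (rotation G (2 * k) (mid f k))"
    "fst (r (Suc k)) = snd (rotation G (2 * k) (mid f k))" if "k \<in> {1..n}" for k
    using that by (auto simp: r W_eq inp_def incl_first_def incl_last_def)
  have mid_norm: "(norm (snd (r k)))\<^sup>2 + (norm (fst (r (Suc k))))\<^sup>2
      = (norm (snd (f k)))\<^sup>2 + (norm (fst (f (Suc k))))\<^sup>2" if "k \<in> {1..n}" for k
    using rotation_norm[of "fst (mid f k)" "2 * k" "snd (mid f k)"] mid_in[OF f that]
    by (simp add: r_mid[OF that] mem_Times_iff mid_def)
  have out: "direct p + outp h = (fst (rotation G 0 (x, fst (f 1))), snd (f (n + 1)))"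
    by (simp add: direct_def outp_def xy row_first_eq row_last_eq f_def V_op_def)
      (simp add: rotation_def)
  have first: "(norm (fst (rotation G 0 (x, fst (f 1)))))\<^sup>2 + (norm (fst (r 1)))\<^sup>2
      = (norm x)\<^sup>2 + (norm (fst (f 1)))\<^sup>2"
    unfolding r_first by (rule rotation_norm) (use f1 in simp_all)
  have "(\<Sum>k\<in>{1..n + 1}. (norm (h k))\<^sup>2) = (\<Sum>k\<in>{1..n + 1}. (norm (f k))\<^sup>2)"
    using fk by (intro sum.cong) auto
  moreover have "(\<Sum>k\<in>{1..n}. (norm (snd (r k)))\<^sup>2 + (norm (fst (r (Suc k))))\<^sup>2)
      = (\<Sum>k\<in>{1..n}. (norm (snd (f k)))\<^sup>2 + (norm (fst (f (Suc k))))\<^sup>2)"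
    by (intro sum.cong mid_norm) auto
  ultimately show ?thesis
    unfolding r_def[symmetric] N_sq out unfolding xy norm_prod_sq[of "(a, b)" for a b] fst_conv snd_conv
    using first sum_norm_sq_regroup[of r n, unfolded r_last] sum_norm_sq_regroup[of f n] by linarith
qed

lemma M_zero: "0 \<in> M"
  by (simp add: zero_prod_def csubspaceD[OF Q_sub])

lemma M_sub: "csubspace M"
  using chilbert_Times[OF chilbert_UNIV Q_chilbert] unfolding chilbert_def by blast

lemma system_zero: "inp 0 = 0" "outp 0 = 0" "S_op G n 0 = 0" "direct 0 = 0" "N 0 = 0"
proof -
  show "inp 0 = 0" by (rule clinear_on_zero[OF M_sub inp_lin])
  show "outp 0 = 0" by (rule clinear_on_zero[OF K_sub outp_lin])
  show "S_op G n 0 = 0" by (rule clinear_on_zero[OF K_sub S_lin])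
  show "direct 0 = 0"
    using clinear_on_zero[OF P_sub[of 0] G_lin[of 0]] by (simp add: direct_def zero_prod_def)
  show "N 0 = 0" by (simp add: N_def L2_set_def)
qed

text \<open>The energy balance with input 0, each of the two outgoing terms bounded by the
  whole.\<close>

lemma state_le:
  assumes "h \<in> K_sp G n"
  shows S_le: "N (S_op G n h) \<le> N h" and outp_le: "norm (outp h) \<le> N h"
proof -
  have "(N (S_op G n h))\<^sup>2 + (norm (outp h))\<^sup>2 = (N h)\<^sup>2"
    using system_isometry[OF assms M_zero] by (simp add: system_zero)
  then have "(N (S_op G n h))\<^sup>2 \<le> (N h)\<^sup>2" "(norm (outp h))\<^sup>2 \<le> (N h)\<^sup>2"
    by (metis zero_le_power2 le_add_same_cancel1 le_add_same_cancel2)+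
  then show "N (S_op G n h) \<le> N h" "norm (outp h) \<le> N h"
    using N_ge_0 power2_le_imp_le by blast+
qed

lemma inp_le:
  assumes "p \<in> M" shows "N (inp p) \<le> norm p"
proof -
  have "(N (inp p))\<^sup>2 + (norm (direct p))\<^sup>2 = (norm p)\<^sup>2"
    using system_isometry[OF csubspaceD(1)[OF K_sub] assms] by (simp add: system_zero)
  then have "(N (inp p))\<^sup>2 \<le> (norm p)\<^sup>2"
    by (metis zero_le_power2 le_add_same_cancel1)
  then show ?thesis by (rule power2_le_imp_le) simp
qed

text \<open>The norm axioms are those of a finite Hilbert sum; only completeness takes work.\<close>

sublocale resolvent "K_sp G n" N "S_op G n"
proof
  show "csubspace (K_sp G n)" by (rule K_sub)
  show "clinear_on (K_sp G n) (K_sp G n) (S_op G n)" by (rule S_lin)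
  show "N (S_op G n x) \<le> N x" if "x \<in> K_sp G n" for x using that by (rule S_le)
  show "N (x + y) \<le> N x + N y" for x y
  proof -
    have "N (x + y) \<le> L2_set (\<lambda>k. norm (x k) + norm (y k)) {1..n + 1}"
      unfolding N_def by (intro L2_set_mono) (auto intro: norm_triangle_ineq)
    then show ?thesis
      using L2_set_triangle_ineq[of "\<lambda>k. norm (x k)" "\<lambda>k. norm (y k)" "{1..n + 1}"]
      unfolding N_def by linarith
  qed
  show "N (a *C x) = cmod a * N x" for a x
    by (simp add: N_def norm_scaleC L2_set_right_distrib)
  show "x = 0" if "x \<in> K_sp G n" "N x = 0" for x
    using that by (auto simp: N_def L2_set_eq_0_iff K_sp_def fun_eq_iff)
  show "\<exists>h\<in>K_sp G n. (\<lambda>j. N (h - (\<Sum>i<j. s i))) \<longlonglongrightarrow> 0"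
    if s: "\<And>j. s j \<in> K_sp G n" and summable: "summable (\<lambda>j. N (s j))" for s
  proof -
    \<comment> \<open>\<open>N\<close> dominates the norm of each component, so the series converges
      componentwise inside the closed \<open>H_sp G k\<close>. With finitely many components this is
      convergence in \<open>N\<close>.\<close>
    define h where "h k = (if k \<in> {1..n + 1} then \<Sum>j. s j k else 0)" for k
    have sums: "(\<lambda>j. \<Sum>i<j. s i k) \<longlonglongrightarrow> h k" if k: "k \<in> {1..n + 1}" for k
    proof -
      have "norm (s j k) \<le> N (s j)" for j
        unfolding N_def by (rule member_le_L2_set[where f = "\<lambda>k. norm (s j k)"]) (use k in auto)
      then have "summable (\<lambda>j. s j k)"
        by (intro summable_comparison_test[OF _ summable]) auto
      then show ?thesis using k by (simp add: h_def summable_LIMSEQ)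
    qed
    have part: "(\<Sum>i<j. s i) \<in> K_sp G n" for j
      by (induction j) (simp_all only: lessThan_0 sum.empty sum.lessThan_Suc csubspaceD(1,2)[OF K_sub] s)
    have "h k \<in> H_sp G k" if k: "k \<in> {1..n + 1}" for k
    proof (rule closed_sequentially[OF _ _ sums[OF k]])
      show "closed (H_sp G k)" using H_sp_chilbert[of k] k by (simp add: chilbert_def)
      show "(\<Sum>i<j. s i k) \<in> H_sp G k" for j
        using part[of j] k unfolding K_sp_def by (auto simp: sum_fun_apply)
    qed
    then have "h \<in> K_sp G n" by (auto simp: K_sp_def h_def)
    moreover have "(\<lambda>j. N (h - (\<Sum>i<j. s i))) \<longlonglongrightarrow> 0"
    proof (rule Lim_null_comparison)
      show "(\<lambda>j. \<Sum>k\<in>{1..n + 1}. norm (h k - (\<Sum>i<j. s i k))) \<longlonglongrightarrow> 0"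
      proof (rule tendsto_null_sum)
        fix k assume "k \<in> {1..n + 1}"
        then have "(\<lambda>j. norm (h k - (\<Sum>i<j. s i k))) \<longlonglongrightarrow> norm (h k - h k)"
          by (intro tendsto_intros sums)
        then show "(\<lambda>j. norm (h k - (\<Sum>i<j. s i k))) \<longlonglongrightarrow> 0" by simp
      qed
      show "\<forall>\<^sub>F j in sequentially. norm (N (h - (\<Sum>i<j. s i))) \<le> (\<Sum>k\<in>{1..n + 1}. norm (h k - (\<Sum>i<j. s i k)))"
      proof (intro always_eventually allI)
        fix j
        show "norm (N (h - (\<Sum>i<j. s i))) \<le> (\<Sum>k\<in>{1..n + 1}. norm (h k - (\<Sum>i<j. s i k)))"
          using L2_set_le_sum[of "{1..n + 1}" "\<lambda>k. norm (h k - (\<Sum>i<j. s i k))"]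
          by (simp add: N_def sum_fun_apply)
      qed
    qed
    ultimately show ?thesis by blast
  qed
qed

section \<open>The function Q as a transfer function\<close>

lemma I_minus_zS_eq: "I_minus_zS G n z = E z"
  by (simp add: I_minus_zS_def E_def fun_eq_iff)

lemma R_op_eq: "R_op G n z = R z"
  by (simp add: R_op_def R_def I_minus_zS_eq)

text \<open>The four entries apply the resolvent to the two inputs separately; linearity merges them
  into one state.\<close>

lemma Q_fun_eq:
  assumes z: "cmod z < 1" and p: "p \<in> M"
  shows "Q_fun G n z p = direct p + z *C outp (R z (inp p))"
proof -
  have "outp (R z (inp p)) = outp (R z (incl_first (dop G 0 (fst p)))) + outp (R z (incl_last n (snd p)))"
    unfolding inp_def using inp_in[OF p] z
    by (simp add: clinear_onD(2)[OF R_lin] clinear_onD(2)[OF outp_lin] R_in)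
  then show ?thesis
    by (simp add: Q_fun_def Theta0_fun_def A_fun_def B_fun_def C_fun_def R_op_eq direct_def outp_def
        scaleC_prod_def scaleC_add_right split: prod.split)
qed

lemma Q_fun_lin:
  assumes z: "cmod z < 1"
  shows "clinear_on M (UNIV \<times> P (2 * n + 2)) (Q_fun G n z)"
proof -
  have d: "clinear_on M (UNIV \<times> P (2 * n + 2)) direct"
    using clinear_onD[OF G_lin[of 0]] csubspaceD[OF P_sub[of "2 * n + 2"]]
    by (auto simp: clinear_on_def direct_def scaleC_prod_def)
  have o: "clinear_on M (UNIV \<times> P (2 * n + 2)) (\<lambda>p. outp (R z (inp p)))"
    by (intro clinear_on_compose[OF _ outp_lin] clinear_on_compose[OF inp_lin] R_lin z)
  have sub: "csubspace ((UNIV :: 'n set) \<times> P (2 * n + 2))"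
    using chilbert_Times[OF chilbert_UNIV P_chilbert] unfolding chilbert_def by blast
  have "clinear_on M (UNIV \<times> P (2 * n + 2)) (\<lambda>p. direct p + z *C outp (R z (inp p)))"
    unfolding clinear_on_def
  proof (intro conjI ballI allI)
    show "direct p + z *C outp (R z (inp p)) \<in> UNIV \<times> P (2 * n + 2)" if "p \<in> M" for p
      by (rule csubspaceD(2)[OF sub clinear_onD(1)[OF d that] csubspaceD(3)[OF sub clinear_onD(1)[OF o that]]])
  qed (simp_all only: clinear_onD(2,3)[OF d] clinear_onD(2,3)[OF o] scaleC_add_right scaleC_commute add_ac)
  then show ?thesis
    unfolding clinear_on_def using Q_fun_eq[OF z] csubspaceD[OF M_sub] by auto
qed

text \<open>The balance for the state \<open>z *C h\<close> with \<open>h = R z (inp p)\<close>: the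
  next state is \<open>h\<close> again and the output is \<open>Q_fun G n z p\<close>.\<close>

lemma Q_fun_energy:
  assumes z: "cmod z < 1" and p: "p \<in> M"
  shows "(N (R z (inp p)))\<^sup>2 + (norm (Q_fun G n z p))\<^sup>2 = (cmod z * N (R z (inp p)))\<^sup>2 + (norm p)\<^sup>2"
proof -
  define h where "h = R z (inp p)"
  have h: "h \<in> K_sp G n" unfolding h_def by (intro R_in z clinear_onD(1)[OF inp_lin] p)
  have "S_op G n (z *C h) + inp p = h"
    using R_fixpoint[OF z clinear_onD(1)[OF inp_lin p]] unfolding h_def by simp
  moreover have "direct p + outp (z *C h) = Q_fun G n z p"
    using Q_fun_eq[OF z p] clinear_onD(3)[OF outp_lin h] by (simp add: h_def)
  ultimately show ?thesis
    using system_isometry[OF csubspaceD(3)[OF K_sub h, of z] p] N_scale[OF h, of z]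
    by (simp add: h_def)
qed

lemma Q_fun_contractive:
  assumes "cmod z < 1" "p \<in> M" shows "norm (Q_fun G n z p) \<le> norm p"
proof -
  have "cmod z * N (R z (inp p)) \<le> 1 * N (R z (inp p))"
    using assms by (intro mult_right_mono N_ge_0) simp
  then have "(cmod z * N (R z (inp p)))\<^sup>2 \<le> (N (R z (inp p)))\<^sup>2"
    by (intro power_mono) (simp_all add: N_ge_0)
  then have "(norm (Q_fun G n z p))\<^sup>2 \<le> (norm p)\<^sup>2" using Q_fun_energy[OF assms] by linarith
  then show ?thesis by (rule power2_le_imp_le) simp
qed

lemma Q_fun_schur_class: "Q_fun G n \<in> schur_class M (UNIV \<times> P (2 * n + 2))"
  unfolding schur_class_def bounded_op_iff
  using Q_fun_lin Q_fun_contractive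
    transfer_function_holomorphic[OF inp_lin inp_le outp_lin outp_le Q_fun_eq]
  by (auto intro!: exI[of _ 1])

lemma A_fun_eq:
  assumes z: "cmod z < 1"
  shows "A_fun G n z = (\<lambda>y. snd (Q_fun G n z (0, y)))"
proof -
  have "B_fun G n z 0 = 0"
    using clinear_on_zero[OF K_sub R_lin[OF z]] clinear_on_zero[OF P_sub dop_lin[of 0]] system_zero(2)
      clinear_on_zero[OF P_sub incl_first_lin]
    by (simp add: B_fun_def R_op_eq outp_def zero_prod_def)
  then show ?thesis by (simp add: Q_fun_def)
qed

lemma A_fun_lin:
  assumes z: "cmod z < 1"
  shows "clinear_on (Q (2 * n + 2)) (P (2 * n + 2)) (A_fun G n z)"
proof -
  have "clinear_on (Q (2 * n + 2)) M (\<lambda>y. (0, y))"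
    by (auto simp: clinear_on_def scaleC_prod_def)
  then have "clinear_on (Q (2 * n + 2)) (P (2 * n + 2)) (\<lambda>y. snd (Q_fun G n z (0, y)))"
    by (intro clinear_on_snd[OF clinear_on_compose[OF _ Q_fun_lin[OF z]]])
  then show ?thesis by (simp only: A_fun_eq[OF z])
qed

text \<open>The Schwarz lemma for \<open>A_fun\<close>, read off from the energy balance instead of from
  holomorphy.\<close>

lemma A_fun_le:
  assumes z: "cmod z < 1" and y: "y \<in> Q (2 * n + 2)"
  shows "norm (A_fun G n z y) \<le> cmod z * norm y"
proof -
  have p: "(0, y) \<in> M" using y by simp
  define h where "h = R z (inp (0, y))"
  have h: "h \<in> K_sp G n" unfolding h_def by (intro R_in z clinear_onD(1)[OF inp_lin] p)
  have A: "A_fun G n z y = snd (Q_fun G n z (0, y))" by (simp add: A_fun_eq[OF z])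
  also have "\<dots> = z *C snd (outp h)"
    by (simp add: Q_fun_eq[OF z p] direct_def scaleC_prod_def h_def)
  finally have "norm (A_fun G n z y) \<le> cmod z * N h"
    using norm_snd_le[of "snd (outp h)" "fst (outp h)"] outp_le[OF h]
    by (simp add: norm_scaleC mult_left_mono)
  then have "(norm (A_fun G n z y))\<^sup>2 \<le> (cmod z)\<^sup>2 * (N h)\<^sup>2"
    using power_mono[of "norm (A_fun G n z y)" "cmod z * N h" 2] by (simp add: power_mult_distrib)
  moreover have "(norm (A_fun G n z y))\<^sup>2 \<le> (norm (Q_fun G n z (0, y)))\<^sup>2"
    unfolding A norm_prod_sq by simp
  moreover have "(N h)\<^sup>2 + (norm (Q_fun G n z (0, y)))\<^sup>2 = (cmod z)\<^sup>2 * (N h)\<^sup>2 + (norm y)\<^sup>2"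
    using Q_fun_energy[OF z p] by (simp add: h_def power_mult_distrib norm_Pair)
  ultimately have "(norm (A_fun G n z y))\<^sup>2 \<le> (cmod z)\<^sup>2 * (N h)\<^sup>2"
    "(norm (A_fun G n z y))\<^sup>2 \<le> (norm y)\<^sup>2 - (1 - (cmod z)\<^sup>2) * (N h)\<^sup>2"
    unfolding left_diff_distrib by linarith+
  \<comment> \<open>With \<open>r = (cmod z)\<^sup>2\<close> and \<open>H = (N h)\<^sup>2\<close>,
    the weights \<open>1 - r\<close> and \<open>r\<close> on the two bounds are those for which
    \<open>H\<close> cancels.\<close>
  moreover have "a \<le> r * b" if "a \<le> r * H" "a \<le> b - (1 - r) * H" "0 \<le> r" "r \<le> 1" for a b r H :: real
  proof -
    have "r * a \<le> r * (b - (1 - r) * H)" "(1 - r) * a \<le> (1 - r) * (r * H)"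
      using that by (auto intro: mult_left_mono)
    then show ?thesis by (simp add: algebra_simps)
  qed
  moreover have "(cmod z)\<^sup>2 \<le> 1" using z by (simp add: power_le_one)
  ultimately have "(norm (A_fun G n z y))\<^sup>2 \<le> (cmod z * norm y)\<^sup>2"
    by (simp add: power_mult_distrib)
  then show ?thesis
    by (rule power2_le_imp_le[OF _ mult_nonneg_nonneg[OF norm_ge_zero norm_ge_zero]])
qed

end

section \<open>The Schur algorithm\<close>

text \<open>The induction hypothesis at the point 0 makes \<open>G k\<close> a contraction. Only
  then are its defect spaces Hilbert spaces, between which the next associated function
  acts.\<close>

lemma schur_algorithm_contraction:
  fixes F :: "complex \<Rightarrow> 'm::complex_hilbert \<Rightarrow> 'n::complex_hilbert"
  assumes F: "F \<in> schur_class UNIV UNIV" and alg: "schur_algorithm F T G"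
  shows "z \<in> ball 0 1 \<Longrightarrow> contraction (par_dom G k) (par_cod G k) (T k z)"
proof (induction k arbitrary: z)
  case 0
  then show ?case
    using F alg by unfold_locales (auto simp: schur_class_def schur_algorithm_def chilbert_UNIV)
next
  case (Suc k)
  have "G k = T k 0" using alg by (simp add: schur_algorithm_def)
  then interpret c: contraction "par_dom G k" "par_cod G k" "G k"
    using Suc.IH[of 0] by simp
  interpret adj: contraction "par_cod G k" "par_dom G k" "par_adj G k"
    unfolding par_adj_def by (rule c.adj_contraction)
  have "T (Suc k) \<in> schur_class (dsp G k) (dsp_star G k)"
    using alg by (simp add: schur_algorithm_def)
  then show ?case
    using Suc.prems c.defect_space_chilbert adj.defect_space_chilbert
    by unfold_locales (auto simp: schur_class_def dsp_def dsp_star_def)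
qed

locale schur_sequence = schur_parameters G n
  for G :: "nat \<Rightarrow> 'm::complex_hilbert \<Rightarrow> 'n::complex_hilbert" and n +
  fixes F :: "complex \<Rightarrow> 'm \<Rightarrow> 'n" and T :: "nat \<Rightarrow> complex \<Rightarrow> 'm \<Rightarrow> 'n"
  assumes alg: "schur_algorithm F T G"
    and T_contraction: "z \<in> ball 0 1 \<Longrightarrow> contraction (P k) (Q k) (T k z)"
begin

lemma T_lin: "z \<in> ball 0 1 \<Longrightarrow> clinear_on (P k) (Q k) (T k z)"
  by (rule contraction.lin[OF T_contraction])

lemma dsp_eq: "dsp G k = P (Suc k)" and dsp_star_eq: "dsp_star G k = Q (Suc k)"
  by (simp_all add: dsp_def dsp_star_def par_dom.simps(2) par_cod.simps(2))

text \<open>The inverse in the algorithm is genuine because \<open>z\<close> times a product of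
  contractions has norm at most \<open>cmod z\<close>; \<open>v\<close> is the preimage of
  \<open>dop G k u\<close>.\<close>

lemma schur_step:
  assumes z: "z \<in> ball 0 1" and u: "u \<in> P k"
  shows "\<exists>v\<in>P (Suc k). rotation G k (u, z *C T (Suc k) z v) = (T k z u, v)"
proof -
  have z1: "cmod z < 1" using z by simp
  \<comment> \<open>The sign brings the map into the form \<open>v - f v\<close> that the
    fixed-point lemma inverts.\<close>
  define f where "f v = - (z *C par_adj G k (T (Suc k) z v))" for v
  have pl: "clinear_on (P (Suc k)) (P (Suc k)) (\<lambda>v. par_adj G k (T (Suc k) z v))"
    by (rule clinear_on_compose[OF T_lin[OF z] par_adj_lin])
  have f_lin: "clinear_on (P (Suc k)) (P (Suc k)) f"
    unfolding clinear_on_def f_def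
    by (auto simp: clinear_onD[OF pl] csubspaceD[OF P_sub] scaleC_add_right scaleC_minus_right scaleC_commute)
  have f_le: "norm (f v) \<le> cmod z * norm v" if v: "v \<in> P (Suc k)" for v
  proof -
    have t: "T (Suc k) z v \<in> Q (Suc k)" by (rule clinear_onD(1)[OF T_lin[OF z] v])
    then have "T (Suc k) z v \<in> Q k" using Q_Suc_subset by blast
    then have "norm (par_adj G k (T (Suc k) z v)) \<le> norm (T (Suc k) z v)"
      by (rule contraction.contr[OF adj_contraction])
    also have "\<dots> \<le> norm v" by (rule contraction.contr[OF T_contraction[OF z] v])
    finally show ?thesis by (simp add: f_def norm_scaleC mult_left_mono)
  qed
  have bij: "bij_betw (\<lambda>v. v + z *C par_adj G k (T (Suc k) z v)) (P (Suc k)) (P (Suc k))"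
    using bij_betw_diff_contraction[OF P_chilbert f_lin f_le _ z1] by (simp add: f_def)
  have d: "dop G k u \<in> P (Suc k)" by (rule clinear_onD(1)[OF dop_lin u])
  define v where "v = the_inv_into (P (Suc k)) (\<lambda>v. v + z *C par_adj G k (T (Suc k) z v)) (dop G k u)"
  have v: "v \<in> P (Suc k)"
    unfolding v_def using bij d by (intro the_inv_into_into) (auto simp: bij_betw_def)
  have veq: "v + z *C par_adj G k (T (Suc k) z v) = dop G k u"
    unfolding v_def
    using bij d by (intro f_the_inv_into_f[of "\<lambda>v. v + z *C par_adj G k (T (Suc k) z v)"])
      (auto simp: bij_betw_def)
  have t: "T (Suc k) z v \<in> Q (Suc k)" by (rule clinear_onD(1)[OF T_lin[OF z] v])
  have tk: "T (Suc k) z v \<in> Q k" using t Q_Suc_subset by blast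
  have "T k z u = G k u + z *C dop_star G k (T (Suc k) z v)"
    using alg z u unfolding schur_algorithm_def v_def dsp_eq by blast
  then have "rotation G k (u, z *C T (Suc k) z v) = (T k z u, v)"
    using veq
    by (auto simp: rotation_def clinear_onD(3)[OF dop_star_lin tk] clinear_onD(3)[OF par_adj_lin t]
        algebra_simps)
  then show ?thesis using v by blast
qed

text \<open>With \<open>rotation G k (u k, z t (k + 1)) = (t k, u (k + 1))\<close>, the state with components
  \<open>(z ^ (k - 1) u (2 k - 1), z ^ k t (2 k))\<close> solves the state equation for the input \<open>(x, y)\<close>
  with \<open>y = z ^ (n + 1) t (2 n + 2)\<close>.\<close>

lemma Q_fun_schur_chain:
  assumes z: "z \<in> ball 0 1"
  shows "\<exists>v\<in>P (2 * n + 2). Q_fun G n z (x, T (2 * n + 2) z v) = (F z x, v)"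
proof -
  have z1: "cmod z < 1" using z by simp
  have "\<exists>u. (u 0 = x \<and> u 0 \<in> P 0) \<and> (\<forall>k. u k \<in> P k) \<and>
    (\<forall>k. rotation G k (u k, z *C T (Suc k) z (u (Suc k))) = (T k z (u k), u (Suc k)))"
  proof -
    have "\<exists>u. \<forall>k. (u k \<in> P k \<and> (k = 0 \<longrightarrow> u k = x)) \<and>
      rotation G k (u k, z *C T (Suc k) z (u (Suc k))) = (T k z (u k), u (Suc k))"
      by (rule dependent_nat_choice) (use schur_step[OF z] in auto)
    then show ?thesis by blast
  qed
  then obtain u where u0: "u 0 = x" and u: "\<And>k. u k \<in> P k"
    and step: "\<And>k. rotation G k (u k, z *C T (Suc k) z (u (Suc k))) = (T k z (u k), u (Suc k))"
    by blast
  define t where "t k = T k z (u k)" for k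
  have t: "t k \<in> Q k" for k unfolding t_def by (rule clinear_onD(1)[OF T_lin[OF z] u])
  \<comment> \<open>By linearity a step may carry any scalar; the powers of \<open>z\<close> are
    inserted here.\<close>
  have rot: "rotation G k (a *C u k, a *C z *C t (Suc k)) = (a *C t k, a *C u (Suc k))" for a k
    using clinear_onD(3)[OF rotation_lin, of "(u k, z *C t (Suc k))" k a] u[of k] t[of "Suc k"]
      step[of k] csubspaceD(3)[OF Q_sub]
    by (simp add: scaleC_Pair t_def)
  define h where "h k = (if k \<in> {1..n + 1} then (z ^ (k - 1) *C u (2 * k - 1), z ^ k *C t (2 * k)) else 0)" for k
  have h: "h \<in> K_sp G n"
    using u t csubspaceD(3)[OF P_sub] csubspaceD(3)[OF Q_sub]
    by (auto simp: K_sp_def h_def H_sp_eq)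
  define y where "y = z ^ (n + 1) *C t (2 * n + 2)"
  have y: "y \<in> Q (2 * n + 2)" unfolding y_def by (rule csubspaceD(3)[OF Q_sub t])
  have rot_odd: "rotation G (2 * k - 1) (h k) = (z ^ (k - 1) *C t (2 * k - 1), z ^ (k - 1) *C u (2 * k))"
    if k: "k \<in> {1..n + 1}" for k
  proof -
    \<comment> \<open>The second entry of \<open>h k\<close> has one more power of \<open>z\<close>
      than the first, which is the factor \<open>z\<close> that a rotation step requires.\<close>
    have "z ^ k = z ^ (k - 1) * z" "Suc (2 * k - 1) = 2 * k" using k by (cases k; simp)+
    then show ?thesis
      using rot[of "2 * k - 1" "z ^ (k - 1)"] k by (simp add: h_def scaleC_scaleC)
  qed
  define f where "f = V_op G n h"
  have f: "f k = (z ^ (k - 1) *C t (2 * k - 1), z ^ (k - 1) *C u (2 * k))" if "k \<in> {1..n + 1}" for k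
    using rot_odd[OF that] that by (simp add: f_def V_op_def)
  have rot_even: "rotation G (2 * k) (mid f k) = (z ^ (k - 1) *C t (2 * k), z ^ (k - 1) *C u (Suc (2 * k)))"
    if k: "k \<in> {1..n}" for k
  proof -
    have "z ^ k = z ^ (k - 1) * z" using k by (cases k) simp_all
    then have "mid f k = (z ^ (k - 1) *C u (2 * k), z ^ (k - 1) *C z *C t (Suc (2 * k)))"
      using f[of k] f[of "Suc k"] k by (simp add: mid_def scaleC_scaleC)
    then show ?thesis by (simp add: rot)
  qed
  \<comment> \<open>The rotation with index 0 is split: its first row gives the output, its second
    row the first entry of the state.\<close>
  have first: "z *C dop_star G 0 (t 1) + G 0 x = t 0" "dop G 0 x - z *C par_adj G 0 (t 1) = u 1"
  proof -
    have t1: "t (Suc 0) \<in> Q (Suc 0)" "t (Suc 0) \<in> Q 0" using t[of 1] by auto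
    have "rotation G 0 (x, z *C t 1) = (t 0, u 1)" using rot[of 0 1] by (simp add: u0)
    then show "z *C dop_star G 0 (t 1) + G 0 x = t 0" "dop G 0 x - z *C par_adj G 0 (t 1) = u 1"
      by (auto simp: rotation_def clinear_onD(3)[OF dop_star_lin t1(2)] clinear_onD(3)[OF par_adj_lin t1(1)] add.commute)
  qed
  \<comment> \<open>Entrywise check of \<open>h = z S h + inp\<close>. First entries come from the
    rotation with index \<open>2 * (k - 1)\<close>, second ones from index \<open>2 * k\<close>,
    except that at \<open>k = n + 1\<close> the second entry is the input \<open>y\<close>.\<close>
  have "h k = (z *C W_op G n f) k + inp (x, y) k" for k
  proof (cases "k \<in> {1..n + 1}")
    case True
    have "fst (h k) = fst ((z *C W_op G n f) k + inp (x, y) k)"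
    proof (cases "k = 1")
      case True
      then show ?thesis
        using first(2) f[of 1]
        by (simp add: h_def W_eq inp_def incl_first_def incl_last_def fst_scaleC scaleC_minus_right zero_prod_def algebra_simps)
    next
      case False
      then obtain j where j: "k = Suc j" "j \<in> {1..n}" using True by (cases k) auto
      moreover have "z ^ j = z * z ^ (j - 1)" using j by (cases j) simp_all
      ultimately show ?thesis
        using rot_even[OF j(2)]
        by (simp add: h_def W_eq inp_def incl_first_def incl_last_def fst_scaleC scaleC_scaleC zero_prod_def)
    qed
    moreover have "snd (h k) = snd ((z *C W_op G n f) k + inp (x, y) k)"
    proof (cases "k = n + 1")
      case True
      then show ?thesis
        by (simp add: h_def W_eq inp_def incl_first_def incl_last_def snd_scaleC y_def zero_prod_def)
    next
      case False
      then have j: "k \<in> {1..n}" using True by auto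
      moreover have "z ^ k = z * z ^ (k - 1)" using j by (cases k) simp_all
      ultimately show ?thesis
        using rot_even[OF j]
        by (simp add: h_def W_eq inp_def incl_first_def incl_last_def snd_scaleC scaleC_scaleC zero_prod_def)
    qed
    ultimately show ?thesis by (rule prod_eqI)
  next
    case False
    then show ?thesis by (auto simp: h_def W_eq inp_def incl_first_def incl_last_def)
  qed
  then have "h = z *C W_op G n f + inp (x, y)" by (intro ext) simp
  then have "E z h = inp (x, y)"
    unfolding E_def S_op_def f_def[symmetric] by (metis add_diff_cancel_left')
  then have Rh: "R z (inp (x, y)) = h" by (rule R_eqI[OF z1 h])
  \<comment> \<open>With this power of \<open>z\<close> kept in \<open>v\<close>, linearity alone
    gives \<open>T (2 * n + 2) z v = y\<close>.\<close>
  define v where "v = z ^ (n + 1) *C u (2 * n + 2)"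
  have v: "v \<in> P (2 * n + 2)" unfolding v_def by (rule csubspaceD(3)[OF P_sub u])
  have Tv: "T (2 * n + 2) z v = y"
    unfolding v_def y_def t_def by (rule clinear_onD(3)[OF T_lin[OF z] u])
  have "outp h = (dop_star G 0 (t 1), z ^ n *C u (2 * n + 2))"
    using rot_odd[of 1] rot_odd[of "n + 1"]
    by (simp add: outp_def row_first_eq row_last_eq)
  then have "Q_fun G n z (x, y) = (F z x, v)"
    using y first(1) alg
    by (simp add: Q_fun_eq[OF z1] Rh direct_def scaleC_Pair scaleC_scaleC v_def t_def u0 schur_algorithm_def add.commute)
  then show ?thesis using v Tv by auto
qed

end

text \<open>\<open>the_inv_into\<close> denotes an inverse only for a bijection. The bijectivity of
  \<open>I - z S\<close> and of the two factors to be inverted is therefore claimed along with the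
  formulas.\<close>

theorem theorem4p6:
  fixes \<Theta> :: "complex \<Rightarrow> 'm::{complex_hilbert, second_countable_topology}
                        \<Rightarrow> 'n::{complex_hilbert, second_countable_topology}"
    and T :: "nat \<Rightarrow> complex \<Rightarrow> 'm \<Rightarrow> 'n"
    and \<Gamma> :: "nat \<Rightarrow> 'm \<Rightarrow> 'n"
    and n :: nat
  assumes "\<Theta> \<in> schur_class UNIV UNIV"
    and "schur_algorithm \<Theta> T \<Gamma>"
    and "dsp \<Gamma> (2 * n + 1) \<noteq> {0}"
    and "dsp_star \<Gamma> (2 * n + 1) \<noteq> {0}"
  shows "(\<forall>z\<in>ball 0 1. bij_betw (I_minus_zS \<Gamma> n z) (K_sp \<Gamma> n) (K_sp \<Gamma> n)) \<and>
    Q_fun \<Gamma> n \<in> schur_class (UNIV \<times> dsp_star \<Gamma> (2 * n + 1)) (UNIV \<times> dsp \<Gamma> (2 * n + 1)) \<and>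
    (\<forall>z\<in>ball 0 1.
       bij_betw (\<lambda>y. y - T (2 * n + 2) z (A_fun \<Gamma> n z y))
         (dsp_star \<Gamma> (2 * n + 1)) (dsp_star \<Gamma> (2 * n + 1)) \<and>
       bij_betw (\<lambda>x. x - A_fun \<Gamma> n z (T (2 * n + 2) z x))
         (dsp \<Gamma> (2 * n + 1)) (dsp \<Gamma> (2 * n + 1)) \<and>
       (\<forall>x. \<Theta> z x = Theta0_fun \<Gamma> n z x +
          C_fun \<Gamma> n z (the_inv_into (dsp_star \<Gamma> (2 * n + 1))
            (\<lambda>y. y - T (2 * n + 2) z (A_fun \<Gamma> n z y)) (T (2 * n + 2) z (B_fun \<Gamma> n z x)))) \<and>
       (\<forall>x. \<Theta> z x = Theta0_fun \<Gamma> n z x +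
          C_fun \<Gamma> n z (T (2 * n + 2) z (the_inv_into (dsp \<Gamma> (2 * n + 1))
            (\<lambda>v. v - A_fun \<Gamma> n z (T (2 * n + 2) z v)) (B_fun \<Gamma> n z x)))))"
proof -
  have "contraction (par_dom \<Gamma> k) (par_cod \<Gamma> k) (\<Gamma> k)" for k
    using schur_algorithm_contraction[OF assms(1,2), of 0 k] assms(2)
    by (simp add: schur_algorithm_def)
  then interpret schur_sequence \<Gamma> n \<Theta> T
    by (intro schur_sequence.intro schur_parameters.intro schur_sequence_axioms.intro
        schur_algorithm_contraction[OF assms(1,2)] assms(2))
  have eqs: "dsp_star \<Gamma> (2 * n + 1) = Q (2 * n + 2)" "dsp \<Gamma> (2 * n + 1) = P (2 * n + 2)"
    using dsp_star_eq[of "2 * n + 1"] dsp_eq[of "2 * n + 1"] by simp_all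
  have main: "bij_betw (\<lambda>y. y - T (2 * n + 2) z (A_fun \<Gamma> n z y)) (Q (2 * n + 2)) (Q (2 * n + 2)) \<and>
       bij_betw (\<lambda>x. x - A_fun \<Gamma> n z (T (2 * n + 2) z x)) (P (2 * n + 2)) (P (2 * n + 2)) \<and>
       (\<forall>x. \<Theta> z x = Theta0_fun \<Gamma> n z x + C_fun \<Gamma> n z (the_inv_into (Q (2 * n + 2))
            (\<lambda>y. y - T (2 * n + 2) z (A_fun \<Gamma> n z y)) (T (2 * n + 2) z (B_fun \<Gamma> n z x)))) \<and>
       (\<forall>x. \<Theta> z x = Theta0_fun \<Gamma> n z x + C_fun \<Gamma> n z (T (2 * n + 2) z (the_inv_into (P (2 * n + 2))
            (\<lambda>v. v - A_fun \<Gamma> n z (T (2 * n + 2) z v)) (B_fun \<Gamma> n z x))))"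
    (is "?bijQ \<and> ?bijP \<and> _") if z: "z \<in> ball 0 1" for z
  proof -
    have z1: "cmod z < 1" using z by simp
    note A = A_fun_lin[OF z1] and T = T_lin[OF z, of "2 * n + 2"]
    note T_le = contraction.contr[OF T_contraction[OF z, of "2 * n + 2"]]
    \<comment> \<open>The associated function is contractive and \<open>A_fun\<close> shrinks by
      \<open>cmod z\<close>, so both products have norm at most \<open>cmod z < 1\<close>.\<close>
    have bijQ: ?bijQ
    proof (rule bij_betw_diff_contraction[OF Q_chilbert clinear_on_compose[OF A T] _ norm_ge_zero z1])
      show "norm (T (2 * n + 2) z (A_fun \<Gamma> n z y)) \<le> cmod z * norm y" if "y \<in> Q (2 * n + 2)" for y
        using T_le[OF clinear_onD(1)[OF A that]] A_fun_le[OF z1 that] by (rule order_trans)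
    qed
    have bijP: ?bijP
    proof (rule bij_betw_diff_contraction[OF P_chilbert clinear_on_compose[OF T A] _ norm_ge_zero z1])
      show "norm (A_fun \<Gamma> n z (T (2 * n + 2) z v)) \<le> cmod z * norm v" if "v \<in> P (2 * n + 2)" for v
        using A_fun_le[OF z1 clinear_onD(1)[OF T that]] mult_left_mono[OF T_le[OF that] norm_ge_zero]
        by (rule order_trans)
    qed
    have "\<Theta> z x = Theta0_fun \<Gamma> n z x + C_fun \<Gamma> n z (the_inv_into (Q (2 * n + 2))
            (\<lambda>y. y - T (2 * n + 2) z (A_fun \<Gamma> n z y)) (T (2 * n + 2) z (B_fun \<Gamma> n z x)))"
      and "\<Theta> z x = Theta0_fun \<Gamma> n z x + C_fun \<Gamma> n z (T (2 * n + 2) z (the_inv_into (P (2 * n + 2))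
            (\<lambda>v. v - A_fun \<Gamma> n z (T (2 * n + 2) z v)) (B_fun \<Gamma> n z x)))" for x
    proof -
      obtain v where v: "v \<in> P (2 * n + 2)" and Qv: "Q_fun \<Gamma> n z (x, T (2 * n + 2) z v) = (\<Theta> z x, v)"
        using Q_fun_schur_chain[OF z] by blast
      define y where "y = T (2 * n + 2) z v"
      have y: "y \<in> Q (2 * n + 2)" unfolding y_def by (rule clinear_onD(1)[OF T v])
      \<comment> \<open>Writing \<open>T\<close> and \<open>A\<close> for the operators at
        \<open>z\<close>, the second component says \<open>(I - A T) v = B x\<close>. Applying
        \<open>T\<close> gives \<open>(I - T A) y = T (B x)\<close> for \<open>y = T v\<close>;
        these are the equations behind the two formulas.\<close>
      have \<Theta>: "\<Theta> z x = Theta0_fun \<Gamma> n z x + C_fun \<Gamma> n z y" and "v = B_fun \<Gamma> n z x + A_fun \<Gamma> n z y"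
        using Qv by (auto simp: Q_fun_def y_def)
      then have B: "v - A_fun \<Gamma> n z y = B_fun \<Gamma> n z x" by simp
      have "y - T (2 * n + 2) z (A_fun \<Gamma> n z y) = T (2 * n + 2) z (v - A_fun \<Gamma> n z y)"
        using clinear_on_diff[OF P_sub T v clinear_onD(1)[OF A y]] by (simp add: y_def)
      then have "y - T (2 * n + 2) z (A_fun \<Gamma> n z y) = T (2 * n + 2) z (B_fun \<Gamma> n z x)"
        by (simp only: B)
      then have "the_inv_into (Q (2 * n + 2)) (\<lambda>y. y - T (2 * n + 2) z (A_fun \<Gamma> n z y))
          (T (2 * n + 2) z (B_fun \<Gamma> n z x)) = y"
        using the_inv_into_f_f[OF bij_betw_imp_inj_on[OF bijQ] y] by simp
      then show "\<Theta> z x = Theta0_fun \<Gamma> n z x + C_fun \<Gamma> n z (the_inv_into (Q (2 * n + 2))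
            (\<lambda>y. y - T (2 * n + 2) z (A_fun \<Gamma> n z y)) (T (2 * n + 2) z (B_fun \<Gamma> n z x)))"
        by (simp only: \<Theta>)
      have "the_inv_into (P (2 * n + 2)) (\<lambda>v. v - A_fun \<Gamma> n z (T (2 * n + 2) z v)) (B_fun \<Gamma> n z x) = v"
        using the_inv_into_f_f[OF bij_betw_imp_inj_on[OF bijP] v] B by (simp add: y_def)
      then show "\<Theta> z x = Theta0_fun \<Gamma> n z x + C_fun \<Gamma> n z (T (2 * n + 2) z (the_inv_into (P (2 * n + 2))
            (\<lambda>v. v - A_fun \<Gamma> n z (T (2 * n + 2) z v)) (B_fun \<Gamma> n z x)))"
        by (simp only: \<Theta> y_def)
    qed
    with bijQ bijP show ?thesis by blast
  qed
  have "\<forall>z\<in>ball 0 1. bij_betw (I_minus_zS \<Gamma> n z) (K_sp \<Gamma> n) (K_sp \<Gamma> n)"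
    using E_bij by (simp add: I_minus_zS_eq)
  then show ?thesis
    unfolding eqs using Q_fun_schur_class main by blast
qed

end
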